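(* There are positive numbers $d$ and $C$ and a sequence $(X_n)$ of pairwise distinct triangulations of the sphere $\mathbb{S}^2$, of degree at most $d$ and with $\operatorname{diam} X_n\ge 2$, such that $$\lambda_1(X_n)\ge C\left(\frac{\log(\operatorname{diam} X_n)}{\operatorname{diam} X_n}\right)^2$$ for all $n$.
   Context: A triangulation is identified with the graph which is its $1$-skeleton; triangulations are considered up to isomorphism, so "pairwise distinct" means pairwise non-isomorphic. The degree of a graph is the maximum over its vertices of the number of adjacent edges. $\operatorname{diam} X$ is the diameter of $X$ for the path metric in which every edge has length $1$. For a finite connected graph $X$ with vertex set $V(X)$, $\lambda_1(X)$ is the smallest positive eigenvalue of the combinatorial Laplacian $\Delta_X:\mathbb{R}^{V(X)}\to\mathbb{R}^{V(X)}$, $\Delta_X(f)(x)=\sum_{y\sim x}(f(x)-f(y))$, where $y\sim x$ means that $x,y$ are joined by an edge. *)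

theory Defs
  imports "HOL-Analysis.Analysis"
begin

section \<open>Triangulations of the 2-sphere\<close>

text \<open>A finite abstract simplicial complex, given by the set of its (nonempty) simplices;
  the vertices are the elements of \<open>\<Union>K\<close>.\<close>

definition simplicial_cpx :: "'v set set \<Rightarrow> bool" where
  "simplicial_cpx K \<longleftrightarrow>
     finite K \<and> (\<forall>s\<in>K. finite s \<and> s \<noteq> {}) \<and>
     (\<forall>s\<in>K. \<forall>t. t \<subseteq> s \<and> t \<noteq> {} \<longrightarrow> t \<in> K)"

text \<open>The geometric realization, in barycentric coordinates: a point is a convex combination of
  vertices whose support is a simplex of \<open>K\<close>. It carries the subspace topology of the product
  topology on functions, which for a finite complex is the usual one.\<close>

definition realization :: "'v set set \<Rightarrow> ('v \<Rightarrow> real) set" where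
  "realization K = {t. (\<forall>v. 0 \<le> t v) \<and> {v. t v \<noteq> 0} \<in> K \<and> (\<Sum>v | t v \<noteq> 0. t v) = 1}"

definition sphere_triangulation :: "'v set set \<Rightarrow> bool" where
  "sphere_triangulation K \<longleftrightarrow>
     simplicial_cpx K \<and> realization K homeomorphic (sphere 0 1 :: (real^3) set)"


section \<open>Finite simple graphs\<close>

text \<open>A graph is a pair of a vertex set and a set of edges, an edge being a two-element set of
  vertices; in particular \<open>{x, x}\<close> is never an edge.\<close>

type_synonym 'v graph = "'v set \<times> 'v set set"

abbreviation verts :: "'v graph \<Rightarrow> 'v set" where
  "verts G \<equiv> fst G"

abbreviation edges :: "'v graph \<Rightarrow> 'v set set" where
  "edges G \<equiv> snd G"

definition one_skeleton :: "'v set set \<Rightarrow> 'v graph" where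
  "one_skeleton K = (\<Union>K, {e \<in> K. card e = 2})"

definition graph_iso :: "'v graph \<Rightarrow> 'w graph \<Rightarrow> bool" where
  "graph_iso G H \<longleftrightarrow>
     (\<exists>\<phi>. bij_betw \<phi> (verts G) (verts H) \<and>
          (\<forall>x\<in>verts G. \<forall>y\<in>verts G. {x, y} \<in> edges G \<longleftrightarrow> {\<phi> x, \<phi> y} \<in> edges H))"

definition graph_degree :: "'v graph \<Rightarrow> nat" where
  "graph_degree G = Max ((\<lambda>x. card {e \<in> edges G. x \<in> e}) ` verts G)"

text \<open>Path metric with edges of length 1. Both this distance and the diameter are meaningful for
  finite nonempty connected graphs only.\<close>

definition graph_dist :: "'v graph \<Rightarrow> 'v \<Rightarrow> 'v \<Rightarrow> nat" where
  "graph_dist G x y = (LEAST n. (x, y) \<in> {(u, v). {u, v} \<in> edges G} ^^ n)"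

definition graph_diam :: "'v graph \<Rightarrow> nat" where
  "graph_diam G = Max {graph_dist G x y | x y. x \<in> verts G \<and> y \<in> verts G}"


section \<open>The combinatorial Laplacian\<close>

text \<open>An element of \<open>\<real>\<^sup>V\<close> is represented by any function on the vertex type that agrees
  with it on \<open>V\<close>; values outside \<open>V\<close> are irrelevant, so that an eigenvector is required to be
  nonzero on \<open>V\<close>.\<close>

definition laplacian :: "'v graph \<Rightarrow> ('v \<Rightarrow> real) \<Rightarrow> 'v \<Rightarrow> real" where
  "laplacian G f x = (\<Sum>y | {x, y} \<in> edges G. f x - f y)"

definition laplacian_eigenvalue :: "'v graph \<Rightarrow> real \<Rightarrow> bool" where
  "laplacian_eigenvalue G \<mu> \<longleftrightarrow>
     (\<exists>f. (\<exists>x\<in>verts G. f x \<noteq> 0) \<and> (\<forall>x\<in>verts G. laplacian G f x = \<mu> * f x))"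

definition lambda1 :: "'v graph \<Rightarrow> real" where
  "lambda1 G = (LEAST \<mu>. 0 < \<mu> \<and> laplacian_eigenvalue G \<mu>)"

end

theory Submission
  imports Defs
begin

text \<open>The triangulations are thin cusps. In the Kuhn triangulation of \<open>\<real>\<^sup>3\<close> consider the body
  \<open>0 \<le> y \<le> S\<close>, \<open>0 \<le> x \<le> \<rho> y\<close>, \<open>0 \<le> z \<le> 1\<close>, where the width \<open>\<rho>\<close> grows by 0 or 1 from each integer to the
  next. Its frontier is a subcomplex, and rescaling \<open>x\<close> maps it to the surface of a cube. With
  \<open>m = 4 ^ K\<close>, the width quadruples over each of \<open>K\<close> blocks of \<open>m\<close> rows, until it has reached \<open>m\<close>, and
  stays constant for \<open>m\<close> more rows. So the diameter is at least \<open>D = (K + 1) m\<close>, and \<open>log D / D\<close> is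
  of order \<open>1 / m\<close>. The exponential growth with rate of order \<open>1 / m\<close> gives a Hardy inequality in the
  direction of the rows with constant of order \<open>m\<^sup>2\<close>, while the final cylinder, whose length and width
  are both \<open>m\<close>, has a Poincare constant of order \<open>m\<^sup>2\<close>. Hence \<open>\<lambda>\<^sub>1\<close> is at least of order \<open>1 / m\<^sup>2\<close>.\<close>

section \<open>The spectral gap of a finite graph\<close>

text \<open>In the cusp only edges between consecutive rows are used: the quantity followed is the
  L2 norm of \<open>f - c\<close> over a whole row, divided by the square root of the row length,
  and averaging the next row onto a shorter one does not increase this normalised norm. So no
  inequality inside narrow rows is needed. Edges inside rows serve only in the cylinder, in one row
  of least energy, where \<open>c\<close> is picked. Blocks of 4 ^ K rows leave room for the last
  widening: with growth at most 1 per row, passing from 4 ^ (K - 1) to 4 ^ K takes 3 * 4 ^ (K - 1)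
  rows. Only a lower bound for the diameter enters, since ln x / x decreases for x \<ge> 3. Taking
  the frontier of a solid body in a fixed triangulation of space gives the degree bound at once and
  avoids gluing sheets by hand; the price is to show that no simplex crosses a wall, and that is
  what restricts the width to steps of 0 or 1.\<close>

definition dirichlet :: "'v graph \<Rightarrow> ('v \<Rightarrow> real) \<Rightarrow> real" where
  "dirichlet G f = (\<Sum>x\<in>verts G. \<Sum>y | {x, y} \<in> edges G. (f x - f y)\<^sup>2)"

locale finite_graph =
  fixes G :: "'v graph"
  assumes finite_verts: "finite (verts G)"
    and edge_subset: "e \<in> edges G \<Longrightarrow> e \<subseteq> verts G"
begin

lemma neighbours_subset: "{y. {x, y} \<in> edges G} \<subseteq> verts G"
  using edge_subset by blast

lemma finite_neighbours: "finite {y. {x, y} \<in> edges G}"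
  using finite_subset[OF neighbours_subset finite_verts] .

lemma sum_neighbours_swap:
  fixes h :: "'v \<Rightarrow> 'v \<Rightarrow> real"
  shows "(\<Sum>x\<in>verts G. \<Sum>y | {x, y} \<in> edges G. h x y) =
    (\<Sum>x\<in>verts G. \<Sum>y | {x, y} \<in> edges G. h y x)"
proof -
  have eq: "(\<Sum>x\<in>verts G. \<Sum>y | {x, y} \<in> edges G. k x y) =
      (\<Sum>x\<in>verts G. \<Sum>y\<in>verts G. if {x, y} \<in> edges G then k x y else 0)" for k :: "'v \<Rightarrow> 'v \<Rightarrow> real"
  proof (rule sum.cong[OF refl])
    fix x assume "x \<in> verts G"
    have "{y. {x, y} \<in> edges G} = {y \<in> verts G. {x, y} \<in> edges G}"
      using neighbours_subset by blast
    then show "(\<Sum>y | {x, y} \<in> edges G. k x y) =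
        (\<Sum>y\<in>verts G. if {x, y} \<in> edges G then k x y else 0)"
      by (simp add: sum.inter_filter finite_verts)
  qed
  show ?thesis
    unfolding eq by (subst sum.swap) (simp add: insert_commute)
qed

lemma green:
  "(\<Sum>x\<in>verts G. laplacian G f x * g x) =
    (\<Sum>x\<in>verts G. \<Sum>y | {x, y} \<in> edges G. (f x - f y) * (g x - g y)) / 2"
proof -
  let ?S = "\<lambda>h. \<Sum>x\<in>verts G. \<Sum>y | {x, y} \<in> edges G. h x y :: real"
  have "?S (\<lambda>x y. (f x - f y) * (g x - g y)) =
      ?S (\<lambda>x y. (f x - f y) * g x) + ?S (\<lambda>x y. (f y - f x) * g y)"
    by (simp add: algebra_simps flip: sum.distrib)
  also have "?S (\<lambda>x y. (f y - f x) * g y) = ?S (\<lambda>x y. (f x - f y) * g x)"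
    by (rule sum_neighbours_swap)
  finally show ?thesis
    by (simp add: laplacian_def sum_distrib_right)
qed

text \<open>The double sum in \<open>dirichlet\<close> meets every edge from both ends; this is the
  origin of the division by 2 here and of the 2 in \<open>lambda1_ge\<close>.\<close>

lemma green_dirichlet: "(\<Sum>x\<in>verts G. laplacian G f x * f x) = dirichlet G f / 2"
  by (simp add: green dirichlet_def power2_eq_square)

lemma sum_laplacian: "(\<Sum>x\<in>verts G. laplacian G f x) = 0"
  using green[of f "\<lambda>_. 1"] by simp

lemma dirichlet_cong: "(\<And>x. x \<in> verts G \<Longrightarrow> f x = g x) \<Longrightarrow> dirichlet G f = dirichlet G g"
  unfolding dirichlet_def using neighbours_subset by (intro sum.cong refl) (metis (mono_tags, lifting) mem_Collect_eq subsetD)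

lemma dirichlet_nonneg: "0 \<le> dirichlet G f"
  unfolding dirichlet_def by (intro sum_nonneg) auto

lemma dirichlet_scale: "dirichlet G (\<lambda>x. c * f x) = c\<^sup>2 * dirichlet G f"
  unfolding dirichlet_def by (simp add: sum_distrib_left power_mult_distrib flip: right_diff_distrib)

text \<open>Prepares a first variation. The coefficient 4 is 2 from the mixed term times 2 from the
  double counting of edges.\<close>

lemma dirichlet_add_scaled:
  "dirichlet G (\<lambda>x. f x + t * g x) =
    dirichlet G f + 4 * t * (\<Sum>x\<in>verts G. laplacian G f x * g x) + t\<^sup>2 * dirichlet G g"
proof -
  have "(f x + t * g x - (f y + t * g y))\<^sup>2 =
      (f x - f y)\<^sup>2 + (2 * t * ((f x - f y) * (g x - g y)) + t\<^sup>2 * (g x - g y)\<^sup>2)" for x y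
    by (simp add: power2_eq_square algebra_simps)
  then show ?thesis
    unfolding dirichlet_def green by (simp add: sum.distrib flip: sum_distrib_left)
qed

section \<open>Minimising the Rayleigh quotient\<close>

definition mean_zero_unit :: "('v \<Rightarrow> real) set" where
  "mean_zero_unit = {f. (\<forall>x. x \<notin> verts G \<longrightarrow> f x = 0) \<and>
     (\<Sum>x\<in>verts G. f x) = 0 \<and> (\<Sum>x\<in>verts G. (f x)\<^sup>2) = 1}"

text \<open>The unit norm bounds every coordinate by 1, so the set is closed in a product of compact
  intervals. Fixing the value 0 off the vertices makes the remaining factors singletons.\<close>

lemma compact_mean_zero_unit: "compact mean_zero_unit"
proof -
  let ?B = "PiE UNIV (\<lambda>x. if x \<in> verts G then {-1..1} else {0}) :: ('v \<Rightarrow> real) set"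
  have "compactin (product_topology (\<lambda>_. euclidean) UNIV) ?B"
    by (subst compactin_PiE) (auto simp: compactin_euclidean_iff)
  then have B: "compact ?B"
    by (simp add: euclidean_product_topology compactin_euclidean_iff)
  have C: "closed {f. (\<Sum>x\<in>verts G. f x) = (0::real)}" "closed {f. (\<Sum>x\<in>verts G. (f x)\<^sup>2) = (1::real)}"
    by (intro closed_Collect_eq continuous_intros continuous_on_product_coordinates)+
  have "mean_zero_unit = ?B \<inter> ({f. (\<Sum>x\<in>verts G. f x) = 0} \<inter> {f. (\<Sum>x\<in>verts G. (f x)\<^sup>2) = 1})"
  proof -
    have "f x \<in> {-1..1}" if "f \<in> mean_zero_unit" "x \<in> verts G" for f x
    proof -
      have "(f x)\<^sup>2 \<le> (\<Sum>x\<in>verts G. (f x)\<^sup>2)"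
        using that finite_verts by (intro member_le_sum) auto
      then have "\<bar>f x\<bar> \<le> 1"
        using that by (simp add: mean_zero_unit_def abs_square_le_1)
      then show ?thesis by auto
    qed
    then show ?thesis
      by (fastforce simp: mean_zero_unit_def PiE_def Pi_def split: if_splits)
  qed
  then show ?thesis
    using B C by (simp add: compact_Int_closed closed_Int)
qed

lemma mean_zero_unit_nonempty:
  assumes "a \<in> verts G" "b \<in> verts G" "a \<noteq> b"
  shows "mean_zero_unit \<noteq> {}"
proof -
  define c where "c = sqrt (1/2)"
  let ?f = "\<lambda>x. if x = a then c else if x = b then - c else (0::real)"
  have s: "(\<Sum>x\<in>verts G. h (?f x)) = h c + h (- c)" if "h 0 = 0" for h :: "real \<Rightarrow> real"
  proof -
    have "(\<Sum>x\<in>verts G. h (?f x)) = (\<Sum>x\<in>{a, b}. h (?f x))"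
      using assms that finite_verts by (intro sum.mono_neutral_right) auto
    then show ?thesis using assms by simp
  qed
  have "?f \<in> mean_zero_unit"
    using s[of "\<lambda>x. x"] s[of "\<lambda>x. x\<^sup>2"] assms by (auto simp: mean_zero_unit_def c_def)
  then show ?thesis by blast
qed

text \<open>The minimum of the Rayleigh quotient over the mean zero functions is attained at an
  eigenvector, which also shows that the set in the definition of \<open>lambda1\<close> has a least element.\<close>

lemma lambda1_ge:
  assumes ab: "a \<in> verts G" "b \<in> verts G" "a \<noteq> b"
    and "A > 0"
    and poincare: "\<And>f. \<exists>c. (\<Sum>x\<in>verts G. (f x - c)\<^sup>2) \<le> A * dirichlet G f"
  shows "lambda1 G \<ge> 1 / (2 * A)"
proof -
  let ?V = "verts G"
  have "continuous_on mean_zero_unit (dirichlet G)"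
    unfolding dirichlet_def
    by (intro continuous_intros continuous_on_subset[OF continuous_on_product_coordinates]) auto
  then obtain f where f: "f \<in> mean_zero_unit" and min: "\<And>g. g \<in> mean_zero_unit \<Longrightarrow> dirichlet G f \<le> dirichlet G g"
    using continuous_attains_inf[OF compact_mean_zero_unit mean_zero_unit_nonempty[OF ab]] by metis
  define \<mu> where "\<mu> = dirichlet G f / 2"
  have fz: "(\<Sum>x\<in>?V. f x) = 0" and f1: "(\<Sum>x\<in>?V. (f x)\<^sup>2) = 1"
    using f by (auto simp: mean_zero_unit_def)
  have rayleigh: "2 * \<mu> * (\<Sum>x\<in>?V. (g x)\<^sup>2) \<le> dirichlet G g" if "(\<Sum>x\<in>?V. g x) = 0" for g
  proof (cases "(\<Sum>x\<in>?V. (g x)\<^sup>2) = 0")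
    case False
    define N where "N = (\<Sum>x\<in>?V. (g x)\<^sup>2)"
    have "N > 0" using False sum_nonneg[of ?V "\<lambda>x. (g x)\<^sup>2"] by (simp add: N_def less_le)
    define s where "s = 1 / sqrt N"
    have s2: "s\<^sup>2 = 1 / N" using \<open>N > 0\<close> by (simp add: s_def power_divide)
    let ?h = "\<lambda>x. if x \<in> ?V then s * g x else 0"
    have "(\<Sum>x\<in>?V. ?h x) = s * (\<Sum>x\<in>?V. g x)" "(\<Sum>x\<in>?V. (?h x)\<^sup>2) = s\<^sup>2 * N"
      by (auto simp: sum_distrib_left power_mult_distrib N_def intro!: sum.cong)
    then have "?h \<in> mean_zero_unit"
      using that \<open>N > 0\<close> s2 by (simp add: mean_zero_unit_def)
    from min[OF this] have "2 * \<mu> \<le> dirichlet G ?h" by (simp add: \<mu>_def)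
    also have "\<dots> = dirichlet G (\<lambda>x. s * g x)" by (rule dirichlet_cong) simp
    also have "\<dots> = dirichlet G g / N" by (simp add: dirichlet_scale s2)
    finally show ?thesis using \<open>N > 0\<close> by (simp add: N_def[symmetric] pos_le_divide_eq)
  qed (simp add: dirichlet_nonneg)
  \<comment> \<open>The mean is the best constant; for mean 0 the Poincare inequality therefore
    holds with constant 0, which bounds \<open>\<mu>\<close> from below.\<close>
  have mean_opt: "(\<Sum>x\<in>?V. (g x)\<^sup>2) \<le> (\<Sum>x\<in>?V. (g x - c)\<^sup>2)" if "(\<Sum>x\<in>?V. g x) = 0" for g and c :: real
  proof -
    have "(\<Sum>x\<in>?V. (g x - c)\<^sup>2) = (\<Sum>x\<in>?V. (g x)\<^sup>2 + c\<^sup>2 - (2 * c) * g x)"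
      by (simp add: power2_diff algebra_simps)
    also have "\<dots> = (\<Sum>x\<in>?V. (g x)\<^sup>2) + (\<Sum>x\<in>?V. c\<^sup>2) - (2 * c) * (\<Sum>x\<in>?V. g x)"
      by (simp add: sum.distrib sum_subtractf sum_distrib_left)
    finally show ?thesis using that by simp
  qed
  obtain c where "(\<Sum>x\<in>?V. (f x - c)\<^sup>2) \<le> A * dirichlet G f" using poincare by blast
  with mean_opt[OF fz, of c] f1 have "1 \<le> A * (2 * \<mu>)" by (simp add: \<mu>_def)
  then have \<mu>_ge: "\<mu> \<ge> 1 / (2 * A)" using \<open>A > 0\<close> by (simp add: field_simps)
  then have "\<mu> > 0" using \<open>A > 0\<close> by (meson divide_pos_pos less_le_trans mult_pos_pos zero_less_numeral zero_less_one)
  \<comment> \<open>The residual of the eigenvalue equation serves as direction of variation. It has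
    mean zero, so \<open>rayleigh\<close> applies to \<open>f + t * r\<close>, and the term linear
    in \<open>t\<close> is \<open>4 * t * R\<close>.\<close>
  define r where "r = (\<lambda>x. laplacian G f x - \<mu> * f x)"
  define R where "R = (\<Sum>x\<in>?V. (r x)\<^sup>2)"
  have rz: "(\<Sum>x\<in>?V. r x) = 0"
    by (simp add: r_def sum_subtractf sum_laplacian fz flip: sum_distrib_left)
  have R: "(\<Sum>x\<in>?V. laplacian G f x * r x) - \<mu> * (\<Sum>x\<in>?V. f x * r x) = R"
    by (simp add: R_def r_def power2_eq_square sum_distrib_left algebra_simps flip: sum_subtractf)
  define Q where "Q = dirichlet G r - 2 * \<mu> * (\<Sum>x\<in>?V. (r x)\<^sup>2)"
  have quad: "0 \<le> 4 * t * R + t\<^sup>2 * Q" for t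
  proof -
    have z: "(\<Sum>x\<in>?V. f x + t * r x) = 0"
      by (simp add: sum.distrib fz rz flip: sum_distrib_left)
    have norm: "(\<Sum>x\<in>?V. (f x + t * r x)\<^sup>2) = (\<Sum>x\<in>?V. (f x)\<^sup>2) + 2 * t * (\<Sum>x\<in>?V. f x * r x) + t\<^sup>2 * (\<Sum>x\<in>?V. (r x)\<^sup>2)"
      by (simp add: power2_sum power_mult_distrib sum.distrib sum_distrib_left algebra_simps)
    from rayleigh[OF z] show ?thesis
      unfolding dirichlet_add_scaled norm f1 R[symmetric] Q_def by (simp add: \<mu>_def algebra_simps)
  qed
  have "R = 0"
  proof (rule ccontr)
    assume "R \<noteq> 0"
    moreover have "R \<ge> 0" by (simp add: R_def sum_nonneg)
    ultimately have "R > 0" by simp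
    \<comment> \<open>Negative, and so small that the quadratic term cannot make up for the linear
      one: \<open>\<bar>t * Q\<bar> \<le> R < 4 * R\<close>.\<close>
    define t where "t = - R / (\<bar>Q\<bar> + 1)"
    have "t < 0" using \<open>R > 0\<close> by (simp add: t_def)
    have "0 \<le> t * (4 * R + t * Q)" using quad[of t] by (simp add: power2_eq_square algebra_simps)
    then have "4 * R + t * Q \<le> 0" using \<open>t < 0\<close> by (simp add: zero_le_mult_iff)
    moreover have "\<bar>t * Q\<bar> \<le> R"
      using \<open>R > 0\<close> by (simp add: t_def abs_mult field_simps)
    ultimately show False using \<open>R > 0\<close> by linarith
  qed
  then have "\<forall>x\<in>?V. r x = 0"
    using finite_verts by (simp add: R_def sum_nonneg_eq_0_iff)
  then have "\<forall>x\<in>?V. laplacian G f x = \<mu> * f x" by (simp add: r_def)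
  moreover have "\<exists>x\<in>?V. f x \<noteq> 0" using f1 by (metis (mono_tags, lifting) sum.neutral zero_neq_one zero_power2)
  ultimately have ev: "laplacian_eigenvalue G \<mu>" by (auto simp: laplacian_eigenvalue_def)
  have "\<mu> \<le> \<nu>" if \<nu>: "0 < \<nu>" "laplacian_eigenvalue G \<nu>" for \<nu>
  proof -
    obtain g where g: "\<exists>x\<in>?V. g x \<noteq> 0" "\<And>x. x \<in> ?V \<Longrightarrow> laplacian G g x = \<nu> * g x"
      using \<nu> by (auto simp: laplacian_eigenvalue_def)
    \<comment> \<open>A Laplacian sums to zero, so an eigenvector with \<open>\<nu> > 0\<close> has
      mean zero and competes in \<open>rayleigh\<close>.\<close>
    have "\<nu> * (\<Sum>x\<in>?V. g x) = 0"
      using sum_laplacian[of g] g(2) by (simp add: sum_distrib_left)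
    then have "2 * \<mu> * (\<Sum>x\<in>?V. (g x)\<^sup>2) \<le> dirichlet G g"
      using \<nu> by (intro rayleigh) simp
    also have "dirichlet G g = 2 * (\<Sum>x\<in>?V. laplacian G g x * g x)"
      by (simp add: green_dirichlet)
    also have "\<dots> = 2 * \<nu> * (\<Sum>x\<in>?V. (g x)\<^sup>2)"
      using g(2) by (simp add: sum_distrib_left power2_eq_square mult.assoc)
    finally have le: "\<mu> * (\<Sum>x\<in>?V. (g x)\<^sup>2) \<le> \<nu> * (\<Sum>x\<in>?V. (g x)\<^sup>2)" by simp
    have "(\<Sum>x\<in>?V. (g x)\<^sup>2) > 0"
      using g(1) finite_verts by (meson sum_pos2 zero_le_power2 zero_less_power2)
    with le show ?thesis by simp
  qed
  then have "lambda1 G = \<mu>"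
    unfolding lambda1_def using ev \<open>\<mu> > 0\<close> by (intro Least_equality) auto
  with \<mu>_ge show ?thesis by simp
qed

text \<open>The indicator function of a connected component has zero energy.\<close>

lemma connected_of_poincare:
  assumes poincare: "\<And>f. \<exists>c. (\<Sum>x\<in>verts G. (f x - c)\<^sup>2) \<le> A * dirichlet G f"
    and "a \<in> verts G" "b \<in> verts G"
  shows "(a, b) \<in> {(u, v). {u, v} \<in> edges G}\<^sup>*"
proof -
  define f where "f x = (if (a, x) \<in> {(u, v). {u, v} \<in> edges G}\<^sup>* then 1 else 0 :: real)" for x
  have "f x = f y" if "{x, y} \<in> edges G" for x y
  proof -
    have "(x, y) \<in> {(u, v). {u, v} \<in> edges G}" "(y, x) \<in> {(u, v). {u, v} \<in> edges G}"
      using that by (auto simp: insert_commute)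
    then show ?thesis
      unfolding f_def by (meson rtrancl.rtrancl_into_rtrancl)
  qed
  then have "dirichlet G f = 0" by (simp add: dirichlet_def)
  then obtain c where "(\<Sum>x\<in>verts G. (f x - c)\<^sup>2) \<le> 0" using poincare[of f] by auto
  moreover have "(\<Sum>x\<in>verts G. (f x - c)\<^sup>2) \<ge> 0" by (simp add: sum_nonneg)
  ultimately have "(\<Sum>x\<in>verts G. (f x - c)\<^sup>2) = 0" by simp
  then have "f a = c" "f b = c" using finite_verts assms by (auto simp: sum_nonneg_eq_0_iff)
  then show ?thesis by (auto simp: f_def split: if_splits)
qed

text \<open>A function rising by at most 1 along edges bounds distances from below. That
  \<open>a\<close> and \<open>b\<close> are joined ensures that the \<open>LEAST\<close> in
  \<open>graph_dist\<close> is attained by a path.\<close>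

lemma graph_diam_ge:
  fixes h :: "'v \<Rightarrow> nat"
  assumes lipschitz: "\<And>x y. {x, y} \<in> edges G \<Longrightarrow> h y \<le> Suc (h x)"
    and ab: "a \<in> verts G" "b \<in> verts G" "(a, b) \<in> {(u, v). {u, v} \<in> edges G}\<^sup>*"
  shows "graph_diam G \<ge> h b - h a"
proof -
  let ?r = "{(u, v). {u, v} \<in> edges G}"
  have path: "h y \<le> h x + n" if "(x, y) \<in> ?r ^^ n" for x y n
    using that
  proof (induction n arbitrary: y)
    case (Suc n)
    then obtain z where "(x, z) \<in> ?r ^^ n" "{z, y} \<in> edges G" by auto
    with Suc.IH[of z] lipschitz[of z y] show ?case by simp
  qed simp
  obtain n where "(a, b) \<in> ?r ^^ n" using ab by (auto simp: rtrancl_power)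
  then have "(a, b) \<in> ?r ^^ graph_dist G a b" unfolding graph_dist_def by (rule LeastI)
  from path[OF this] have "h b - h a \<le> graph_dist G a b" by simp
  also have "\<dots> \<le> graph_diam G"
  proof -
    have "{graph_dist G x y |x y. x \<in> verts G \<and> y \<in> verts G} =
        (\<lambda>(x, y). graph_dist G x y) ` (verts G \<times> verts G)" by auto
    then have "finite {graph_dist G x y |x y. x \<in> verts G \<and> y \<in> verts G}"
      using finite_verts by simp
    then show ?thesis unfolding graph_diam_def using ab by (intro Max_ge) auto
  qed
  finally show ?thesis .
qed

end


section \<open>Barycentric coordinates in the Kuhn triangulation\<close>

text \<open>Lattice points are coded as numbers because the complexes of the theorem have vertices
  in \<open>nat\<close>.\<close>

definition vtx :: "nat \<Rightarrow> nat \<Rightarrow> nat \<Rightarrow> nat" where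
  "vtx x y z = prod_encode (x, prod_encode (y, z))"

definition crd :: "nat \<Rightarrow> nat \<Rightarrow> nat" where
  "crd v d = (let (x, w) = prod_decode v; (y, z) = prod_decode w
     in if d = 0 then x else if d = 1 then y else z)"

lemma crd_vtx [simp]: "crd (vtx x y z) 0 = x" "crd (vtx x y z) (Suc 0) = y" "crd (vtx x y z) 2 = z"
  by (simp_all add: vtx_def crd_def)

lemma vtx_crd: "vtx (crd v 0) (crd v 1) (crd v 2) = v"
  by (simp add: vtx_def crd_def split: prod.split) (metis prod_decode_inverse)

lemma vtx_eq_iff [simp]: "vtx x y z = vtx x' y' z' \<longleftrightarrow> x = x' \<and> y = y' \<and> z = z'"
  by (simp add: vtx_def prod_encode_eq)

lemma less_3_iff: "d < (3::nat) \<longleftrightarrow> d = 0 \<or> d = 1 \<or> d = 2"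
  by auto

lemma crd_eqI: "(\<And>d. d < 3 \<Longrightarrow> crd u d = crd v d) \<Longrightarrow> u = v"
  by (metis vtx_crd less_3_iff)

text \<open>Simplices of the Kuhn (Freudenthal) triangulation of the octant, that is, chains of lattice
  points for the product order inside a unit cube.\<close>

definition le1 :: "nat \<Rightarrow> nat \<Rightarrow> bool" where
  "le1 u v \<longleftrightarrow> (\<forall>d<3. crd u d \<le> crd v d \<and> crd v d \<le> Suc (crd u d))"

definition kuhn :: "nat set \<Rightarrow> bool" where
  "kuhn \<sigma> \<longleftrightarrow> finite \<sigma> \<and> \<sigma> \<noteq> {} \<and> (\<forall>u\<in>\<sigma>. \<forall>v\<in>\<sigma>. le1 u v \<or> le1 v u)"

text \<open>The realization of the infinite Kuhn complex of the octant; \<open>bary\<close> is its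
  map into space.\<close>

definition weights :: "(nat \<Rightarrow> real) set" where
  "weights = {t. (\<forall>v. 0 \<le> t v) \<and> kuhn {v. t v \<noteq> 0} \<and> (\<Sum>v | t v \<noteq> 0. t v) = 1}"

definition wsum :: "(nat \<Rightarrow> real) \<Rightarrow> (nat \<Rightarrow> real) \<Rightarrow> real" where
  "wsum t h = (\<Sum>v | t v \<noteq> 0. t v * h v)"

definition bary :: "(nat \<Rightarrow> real) \<Rightarrow> nat \<Rightarrow> real" where
  "bary t d = wsum t (\<lambda>v. real (crd v d))"

text \<open>Together with \<open>defect\<close> this forms a norm of \<open>p - v\<close>: the
  largest positive plus the largest negative coordinate. Its unit ball about \<open>v\<close> is the
  star of \<open>v\<close>, which explains \<open>hat\<close>.\<close>

definition excess :: "(nat \<Rightarrow> real) \<Rightarrow> nat \<Rightarrow> real" where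
  "excess p v = max 0 (max (p 0 - real (crd v 0)) (max (p 1 - real (crd v 1)) (p 2 - real (crd v 2))))"

definition defect :: "(nat \<Rightarrow> real) \<Rightarrow> nat \<Rightarrow> real" where
  "defect p v = max 0 (max (real (crd v 0) - p 0) (max (real (crd v 1) - p 1) (real (crd v 2) - p 2)))"

text \<open>The barycentric coordinates of \<open>p\<close> in the Kuhn triangulation, in closed form.\<close>

definition hat :: "(nat \<Rightarrow> real) \<Rightarrow> nat \<Rightarrow> real" where
  "hat p v = max 0 (1 - excess p v - defect p v)"

lemma excess_ge: "d < 3 \<Longrightarrow> p d - real (crd v d) \<le> excess p v" "0 \<le> excess p v"
  and excess_le: "0 \<le> (c::real) \<Longrightarrow> (\<And>d. d < 3 \<Longrightarrow> p d - real (crd v d) \<le> c) \<Longrightarrow> excess p v \<le> c"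
  by (auto simp: excess_def less_3_iff)

lemma defect_ge: "d < 3 \<Longrightarrow> real (crd v d) - p d \<le> defect p v" "0 \<le> defect p v"
  and defect_le: "0 \<le> (c::real) \<Longrightarrow> (\<And>d. d < 3 \<Longrightarrow> real (crd v d) - p d \<le> c) \<Longrightarrow> defect p v \<le> c"
  by (auto simp: defect_def less_3_iff)

text \<open>Stated for integer coordinates so that it also applies to the negated ones.\<close>

lemma chain_direction:
  fixes k :: "'a \<Rightarrow> nat \<Rightarrow> int" and v :: "nat \<Rightarrow> int" and t :: "'a \<Rightarrow> real"
  assumes fin: "finite \<sigma>"
    and chain: "\<And>u w. u \<in> \<sigma> \<Longrightarrow> w \<in> \<sigma> \<Longrightarrow>
      (\<forall>d<3. k u d \<le> k w d \<and> k w d \<le> k u d + 1) \<or> (\<forall>d<3. k w d \<le> k u d \<and> k u d \<le> k w d + 1)"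
    and t: "\<And>u. u \<in> \<sigma> \<Longrightarrow> 0 \<le> t u" "sum t \<sigma> = 1"
    and U: "U = {u \<in> \<sigma>. \<exists>d<3. v d < k u d}" "U \<noteq> {}"
  shows "\<exists>d<3. sum t U \<le> (\<Sum>u\<in>\<sigma>. t u * of_int (k u d)) - of_int (v d)"
proof -
  let ?w = "\<lambda>u. k u 0 + k u 1 + k u 2"
  have "finite U" using fin U by simp
  \<comment> \<open>The lowest member of the chain \<open>U\<close>: a coordinate in which it
    exceeds \<open>v\<close> is one in which all of \<open>U\<close> do.\<close>
  then obtain u0 where u0: "u0 \<in> U" "\<And>u. u \<in> U \<Longrightarrow> ?w u0 \<le> ?w u"
    using ex_is_arg_min_if_finite[of U ?w] U(2) unfolding is_arg_min_linorder by blast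
  then obtain d where d: "d < 3" "v d < k u0 d" using U by auto
  have big: "v d + 1 \<le> k u d" if "u \<in> U" for u
  proof -
    have "u \<in> \<sigma>" "u0 \<in> \<sigma>" using that u0 U by auto
    from chain[OF this] have "k u0 d \<le> k u d"
    proof
      assume *: "\<forall>d<3. k u d \<le> k u0 d \<and> k u0 d \<le> k u d + 1"
      then have "k u 0 \<le> k u0 0" "k u 1 \<le> k u0 1" "k u 2 \<le> k u0 2" by auto
      with u0(2)[OF that] have "k u 0 = k u0 0" "k u 1 = k u0 1" "k u 2 = k u0 2" by linarith+
      with d(1) show ?thesis by (auto simp: less_3_iff)
    qed (use d in auto)
    with d show ?thesis by simp
  qed
  \<comment> \<open>In the coordinate \<open>d\<close>, where \<open>u0\<close> is above
    \<open>v\<close>, members of \<open>\<sigma>\<close> lie at most 1 below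
    \<open>u0\<close>.\<close>
  have small: "v d \<le> k u d" if "u \<in> \<sigma>" for u
    using chain[OF that, of u0] u0 U d by fastforce
  have "sum t U = (\<Sum>u\<in>\<sigma>. t u * (if u \<in> U then 1 else 0))"
    using U fin by (simp add: sum.inter_filter mult.commute if_distrib cong: if_cong)
  also have "\<dots> \<le> (\<Sum>u\<in>\<sigma>. t u * of_int (k u d - v d))"
  proof (intro sum_mono mult_left_mono)
    fix u assume "u \<in> \<sigma>"
    then show "(if u \<in> U then 1 else 0) \<le> real_of_int (k u d - v d)"
      using big[of u] small[of u] by auto
  qed (use t in auto)
  also have "\<dots> = (\<Sum>u\<in>\<sigma>. t u * of_int (k u d)) - of_int (v d)"
    using t(2) by (simp add: right_diff_distrib sum_subtractf flip: sum_distrib_right)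
  finally show ?thesis using d by blast
qed

text \<open>\<open>U\<close> and \<open>D\<close> collect the vertices of the simplex that are
  above, respectively below, \<open>v\<close> in some coordinate; \<open>chain_direction\<close>
  bounds their weights by \<open>excess\<close> and \<open>defect\<close>. If \<open>v\<close> is no
  vertex of the simplex, they cover it and nothing is left for \<open>hat\<close>. If it is one,
  they partition the other vertices, equality holds, and \<open>t v\<close> is left.\<close>

lemma hat_bary:
  assumes t: "t \<in> weights"
  shows "hat (bary t) v = t v"
proof -
  define \<sigma> where "\<sigma> = {v. t v \<noteq> 0}"
  have fin: "finite \<sigma>" and chain: "\<And>u w. u \<in> \<sigma> \<Longrightarrow> w \<in> \<sigma> \<Longrightarrow> le1 u w \<or> le1 w u"
    and nn: "\<And>v. 0 \<le> t v" and one: "sum t \<sigma> = 1"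
    using t by (auto simp: weights_def kuhn_def \<sigma>_def)
  have bary: "bary t d = (\<Sum>u\<in>\<sigma>. t u * real (crd u d))" for d
    by (simp add: bary_def wsum_def \<sigma>_def)
  have bary_diff: "bary t d - real (crd v d) = (\<Sum>u\<in>\<sigma>. t u * (real (crd u d) - real (crd v d)))" for d
    using one by (simp add: bary right_diff_distrib sum_subtractf flip: sum_distrib_right)
  define U where "U = {u \<in> \<sigma>. \<exists>d<3. crd v d < crd u d}"
  define D where "D = {u \<in> \<sigma>. \<exists>d<3. crd u d < crd v d}"
  have U0: "0 \<le> sum t U" and D0: "0 \<le> sum t D" using nn by (auto intro: sum_nonneg)
  have finUD: "finite U" "finite D" using fin by (auto simp: U_def D_def)
  have pos: "sum t U \<le> excess (bary t) v"
  proof (cases "U = {}")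
    case False
    have "\<exists>d<3. sum t U \<le> (\<Sum>u\<in>\<sigma>. t u * of_int (int (crd u d))) - of_int (int (crd v d))"
    proof (rule chain_direction[OF fin _ _ one _ False])
      show "(\<forall>d<3. int (crd u d) \<le> int (crd w d) \<and> int (crd w d) \<le> int (crd u d) + 1) \<or>
        (\<forall>d<3. int (crd w d) \<le> int (crd u d) \<and> int (crd u d) \<le> int (crd w d) + 1)"
        if "u \<in> \<sigma>" "w \<in> \<sigma>" for u w
        using chain[OF that] unfolding le1_def by (force simp: le1_def)
    qed (auto simp: U_def nn)
    then obtain d where "d < 3" "sum t U \<le> bary t d - real (crd v d)" by (auto simp: bary)
    then show ?thesis using excess_ge(1)[of d "bary t" v] by linarith
  qed (simp add: excess_ge)
  have neg: "sum t D \<le> defect (bary t) v"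
  proof (cases "D = {}")
    case False
    have "\<exists>d<3. sum t D \<le> (\<Sum>u\<in>\<sigma>. t u * of_int (- int (crd u d))) - of_int (- int (crd v d))"
    proof (rule chain_direction[OF fin _ _ one _ False])
      show "(\<forall>d<3. - int (crd u d) \<le> - int (crd w d) \<and> - int (crd w d) \<le> - int (crd u d) + 1) \<or>
        (\<forall>d<3. - int (crd w d) \<le> - int (crd u d) \<and> - int (crd u d) \<le> - int (crd w d) + 1)"
        if "u \<in> \<sigma>" "w \<in> \<sigma>" for u w
        using chain[OF that] unfolding le1_def by force
    qed (auto simp: D_def nn)
    then obtain d where "d < 3" "sum t D \<le> real (crd v d) - bary t d" by (auto simp: bary sum_negf)
    then show ?thesis using defect_ge(1)[of d v "bary t"] by linarith
  qed (simp add: defect_ge)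
  show ?thesis
  proof (cases "v \<in> \<sigma>")
    case False
    have "\<sigma> \<subseteq> U \<union> D"
    proof
      fix u assume "u \<in> \<sigma>"
      with False have "\<exists>d<3. crd u d \<noteq> crd v d" using crd_eqI by blast
      with \<open>u \<in> \<sigma>\<close> show "u \<in> U \<union> D" by (auto simp: U_def D_def neq_iff)
    qed
    then have "1 \<le> sum t (U \<union> D)"
      unfolding one[symmetric] using finUD nn by (intro sum_mono2) auto
    also have "\<dots> \<le> sum t U + sum t D"
      using sum.union_inter[OF finUD, of t] sum_nonneg[of "U \<inter> D" t] nn by auto
    finally show ?thesis using pos neg False by (simp add: hat_def \<sigma>_def)
  next
    case True
    have v: "le1 u v \<or> le1 v u" if "u \<in> \<sigma>" for u using chain[OF that True] .
    have disj: "U \<inter> D = {}"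
    proof -
      have False if "u \<in> \<sigma>" "d < 3" "crd v d < crd u d" "d' < 3" "crd u d' < crd v d'" for u d d'
        using v[OF that(1)] that unfolding le1_def by (meson leD)
      then show ?thesis by (auto simp: U_def D_def)
    qed
    have un: "U \<union> D = \<sigma> - {v}"
    proof
      show "\<sigma> - {v} \<subseteq> U \<union> D"
      proof
        fix u assume u: "u \<in> \<sigma> - {v}"
        then have "\<exists>d<3. crd u d \<noteq> crd v d" using crd_eqI by blast
        with u show "u \<in> U \<union> D" by (auto simp: U_def D_def neq_iff)
      qed
    qed (auto simp: U_def D_def)
    have "sum t U + sum t D = sum t (\<sigma> - {v})"
      using sum.union_disjoint[OF finUD disj, of t] un by simp
    then have tot: "sum t U + sum t D = 1 - t v"
      using sum.remove[OF fin True, of t] one by simp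
    have sumU: "sum t A = (\<Sum>u\<in>\<sigma>. t u * (if u \<in> A then 1 else 0))" if "A \<subseteq> \<sigma>" for A
    proof -
      have "\<sigma> \<inter> A = A" using that by blast
      then show ?thesis
        using fin by (simp add: mult.commute if_distrib flip: sum.inter_restrict cong: if_cong)
    qed
    have "excess (bary t) v \<le> sum t U"
    proof (rule excess_le[OF U0])
      fix d :: nat assume "d < 3"
      have le: "real (crd u d) - real (crd v d) \<le> (if u \<in> U then 1 else 0)" if "u \<in> \<sigma>" for u
      proof (cases "crd v d < crd u d")
        case True
        then have "u \<in> U" using that \<open>d < 3\<close> by (auto simp: U_def)
        moreover have "crd u d \<le> Suc (crd v d)"
          using v[OF that] \<open>d < 3\<close> True unfolding le1_def by (meson leD)
        ultimately show ?thesis by simp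
      qed simp
      show "bary t d - real (crd v d) \<le> sum t U"
      proof (subst sumU)
        show "bary t d - real (crd v d) \<le> (\<Sum>u\<in>\<sigma>. t u * (if u \<in> U then 1 else 0))"
          unfolding bary_diff using le nn by (intro sum_mono mult_left_mono)
      qed (auto simp: U_def)
    qed
    moreover have "defect (bary t) v \<le> sum t D"
    proof (rule defect_le[OF D0])
      fix d :: nat assume "d < 3"
      have "real (crd v d) - bary t d = (\<Sum>u\<in>\<sigma>. t u * (real (crd v d) - real (crd u d)))"
        using bary_diff[of d] by (simp add: right_diff_distrib sum_subtractf)
      also have "\<dots> \<le> sum t D"
      proof (subst sumU)
        have le: "real (crd v d) - real (crd u d) \<le> (if u \<in> D then 1 else 0)" if "u \<in> \<sigma>" for u
        proof (cases "crd u d < crd v d")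
          case True
          then have "u \<in> D" using that \<open>d < 3\<close> by (auto simp: D_def)
          moreover have "crd v d \<le> Suc (crd u d)"
            using v[OF that] \<open>d < 3\<close> True unfolding le1_def by (meson leD)
          ultimately show ?thesis by simp
        qed simp
        show "(\<Sum>u\<in>\<sigma>. t u * (real (crd v d) - real (crd u d))) \<le>
            (\<Sum>u\<in>\<sigma>. t u * (if u \<in> D then 1 else 0))"
          using le nn by (intro sum_mono mult_left_mono)
      qed (auto simp: D_def)
      finally show "real (crd v d) - bary t d \<le> sum t D" .
    qed
    ultimately show ?thesis using pos neg tot nn[of v] by (simp add: hat_def)
  qed
qed

lemma sorted_directions:
  fixes f :: "nat \<Rightarrow> real"
  obtains d1 d2 d3 where "d1 < 3" "d2 < 3" "d3 < 3" "d1 \<noteq> d2" "d1 \<noteq> d3" "d2 \<noteq> d3"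
    "\<And>d. d < 3 \<longleftrightarrow> d = d1 \<or> d = d2 \<or> d = d3" "f d2 \<le> f d1" "f d3 \<le> f d2"
proof -
  have three: "(0::nat) < 3" "(1::nat) < 3" "(2::nat) < 3" "(0::nat) \<noteq> 1" "(0::nat) \<noteq> 2" "(1::nat) \<noteq> 2"
    by simp_all
  consider "f 1 \<le> f 0" "f 2 \<le> f 1" | "f 2 \<le> f 0" "f 1 \<le> f 2" | "f 0 \<le> f 1" "f 2 \<le> f 0"
    | "f 2 \<le> f 1" "f 0 \<le> f 2" | "f 0 \<le> f 2" "f 1 \<le> f 0" | "f 1 \<le> f 2" "f 0 \<le> f 1"
    by linarith
  then show ?thesis
  proof cases
    case 1 then show ?thesis using that[of 0 1 2] by (auto simp: less_3_iff)
  next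
    case 2 then show ?thesis using that[of 0 2 1] by (auto simp: less_3_iff)
  next
    case 3 then show ?thesis using that[of 1 0 2] by (auto simp: less_3_iff)
  next
    case 4 then show ?thesis using that[of 1 2 0] by (auto simp: less_3_iff)
  next
    case 5 then show ?thesis using that[of 2 0 1] by (auto simp: less_3_iff)
  next
    case 6 then show ?thesis using that[of 2 1 0] by (auto simp: less_3_iff)
  qed
qed

text \<open>Point location in the Kuhn triangulation: from the integer corner below
  \<open>p\<close>, walk along the axes in decreasing order of the fractional parts. The corners met
  form a chain, and the successive differences of 1, the sorted fractional parts and 0 are the
  weights.\<close>

lemma weights_bary_surj:
  assumes p: "\<And>d. d < 3 \<Longrightarrow> 0 \<le> p d"
  obtains t where "t \<in> weights" "\<And>d. d < 3 \<Longrightarrow> bary t d = p d"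
proof -
  define a where "a d = nat \<lfloor>p d\<rfloor>" for d
  define f where "f d = frac (p d)" for d
  have pd: "p d = real (a d) + f d" if "d < 3" for d
    using p[OF that] by (simp add: a_def f_def frac_def)
  obtain d1 d2 d3 where d: "d1 < 3" "d2 < 3" "d3 < 3" "d1 \<noteq> d2" "d1 \<noteq> d3" "d2 \<noteq> d3"
    and all: "\<And>d. d < 3 \<longleftrightarrow> d = d1 \<or> d = d2 \<or> d = d3" and sorted: "f d2 \<le> f d1" "f d3 \<le> f d2"
    by (rule sorted_directions[of f]) blast
  have f01: "0 \<le> f d3" "f d1 < 1" by (simp_all add: f_def frac_lt_1)
  define u where "u (E :: nat set) = vtx (a 0 + of_bool (0 \<in> E)) (a 1 + of_bool (1 \<in> E)) (a 2 + of_bool (2 \<in> E))" for E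
  have crd_u: "crd (u E) d = a d + of_bool (d \<in> E)" if "d < 3" for d E
    using that by (auto simp: u_def less_3_iff)
  have u_inj: "u E \<noteq> u F" if "d \<in> E" "d \<notin> F" "d < 3" for d E F
    using crd_u[of d E] crd_u[of d F] that by auto
  let ?u0 = "u {}" and ?u1 = "u {d1}" and ?u2 = "u {d1, d2}" and ?u3 = "u {d1, d2, d3}"
  have dist: "?u0 \<noteq> ?u1" "?u0 \<noteq> ?u2" "?u0 \<noteq> ?u3" "?u1 \<noteq> ?u2" "?u1 \<noteq> ?u3" "?u2 \<noteq> ?u3"
    using u_inj[of d1 "{d1}" "{}"] u_inj[of d1 "{d1, d2}" "{}"] u_inj[of d1 "{d1, d2, d3}" "{}"]
      u_inj[of d2 "{d1, d2}" "{d1}"] u_inj[of d2 "{d1, d2, d3}" "{d1}"] u_inj[of d3 "{d1, d2, d3}" "{d1, d2}"] d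
    by (metis insert_iff empty_iff)+
  define t where "t v = (if v = ?u0 then 1 - f d1 else if v = ?u1 then f d1 - f d2
     else if v = ?u2 then f d2 - f d3 else if v = ?u3 then f d3 else 0)" for v
  have nn: "0 \<le> t v" for v using f01 sorted by (auto simp: t_def)
  let ?\<sigma> = "{?u0, ?u1, ?u2, ?u3}"
  have supp: "{v. t v \<noteq> 0} \<subseteq> ?\<sigma>" by (auto simp: t_def split: if_splits)
  have le1_u: "le1 (u E) (u F)" if "E \<subseteq> F" for E F
    using that by (auto simp: le1_def crd_u)
  have chain: "le1 v w \<or> le1 w v" if "v \<in> ?\<sigma>" "w \<in> ?\<sigma>" for v w
  proof -
    obtain E F where EF: "v = u E" "w = u F" "E \<in> {{}, {d1}, {d1, d2}, {d1, d2, d3}}"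
      "F \<in> {{}, {d1}, {d1, d2}, {d1, d2, d3}}" using \<open>v \<in> ?\<sigma>\<close> \<open>w \<in> ?\<sigma>\<close> by blast
    then have "E \<subseteq> F \<or> F \<subseteq> E" by auto
    then show ?thesis using le1_u EF by blast
  qed
  have sum_t: "wsum t h = (1 - f d1) * h ?u0 + (f d1 - f d2) * h ?u1 + (f d2 - f d3) * h ?u2 + f d3 * h ?u3" for h
  proof -
    have "wsum t h = (\<Sum>v\<in>?\<sigma>. t v * h v)"
      unfolding wsum_def using supp by (intro sum.mono_neutral_left) auto
    also have "\<dots> = (1 - f d1) * h ?u0 + (f d1 - f d2) * h ?u1 + (f d2 - f d3) * h ?u2 + f d3 * h ?u3"
      using dist by (simp add: t_def)
    finally show ?thesis .
  qed
  have one: "(\<Sum>v | t v \<noteq> 0. t v) = 1"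
    using sum_t[of "\<lambda>_. 1"] by (simp add: wsum_def)
  have "{v. t v \<noteq> 0} \<noteq> {}" using one by (metis sum.empty zero_neq_one)
  moreover have "finite {v. t v \<noteq> 0}" using supp by (rule finite_subset) simp
  ultimately have "kuhn {v. t v \<noteq> 0}"
    unfolding kuhn_def using chain supp by (meson subsetD)
  then have "t \<in> weights" using one nn by (simp add: weights_def)
  moreover have "bary t d = p d" if "d < 3" for d
    using that d all[of d] unfolding bary_def sum_t pd[OF that]
    by (auto simp: crd_u algebra_simps)
  ultimately show ?thesis using that by blast
qed

text \<open>\<open>hat\<close> recovers the weights found by \<open>weights_bary_surj\<close>, hence
  equals them; so it inverts \<open>bary\<close>.\<close>

lemma hat_in_weights:
  assumes p: "\<And>d. d < 3 \<Longrightarrow> 0 \<le> p d"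
  shows "hat p \<in> weights" and "d < 3 \<Longrightarrow> bary (hat p) d = p d"
proof -
  obtain t where t: "t \<in> weights" "\<And>d. d < 3 \<Longrightarrow> bary t d = p d"
    using weights_bary_surj[of p, OF p] by blast
  have "hat p = hat (bary t)" using t(2) by (auto simp: hat_def excess_def defect_def)
  also have "\<dots> = t" using hat_bary[OF t(1)] by auto
  finally show "hat p \<in> weights" "d < 3 \<Longrightarrow> bary (hat p) d = p d" using t by auto
qed

lemma continuous_on_hat:
  assumes "continuous_on T p0" "continuous_on T p1" "continuous_on T p2"
  shows "continuous_on T (\<lambda>q. hat (\<lambda>d. if d = 0 then p0 q else if d = 1 then p1 q else p2 q))"
  unfolding hat_def excess_def defect_def
  by (intro continuous_on_coordinatewise_then_product) (auto intro!: continuous_intros assms)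


section \<open>The frontier of a slab of variable width\<close>

text \<open>Weights are positive on the support, so terms of one sign cannot cancel. With
  \<open>wall_same_sign\<close> this turns conditions on all vertices of a simplex into conditions
  on the barycentric point.\<close>

lemma wsum_zero_iff:
  assumes "t \<in> weights" "(\<forall>v\<in>{v. t v \<noteq> 0}. 0 \<le> h v) \<or> (\<forall>v\<in>{v. t v \<noteq> 0}. h v \<le> 0)"
  shows "wsum t h = 0 \<longleftrightarrow> (\<forall>v\<in>{v. t v \<noteq> 0}. h v = 0)"
proof -
  have aux: "wsum t g = 0 \<longleftrightarrow> (\<forall>v\<in>{v. t v \<noteq> 0}. g v = 0)" if "\<forall>v\<in>{v. t v \<noteq> 0}. 0 \<le> g v" for g
    using assms(1) that unfolding wsum_def weights_def kuhn_def
    by (subst sum_nonneg_eq_0_iff) auto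
  have "wsum t (\<lambda>v. - h v) = - wsum t h" by (simp add: wsum_def sum_negf)
  with aux[of h] aux[of "\<lambda>v. - h v"] assms(2) show ?thesis by auto
qed

lemma wsum_nonpos_iff:
  assumes "t \<in> weights" "(\<forall>v\<in>{v. t v \<noteq> 0}. 0 \<le> h v) \<or> (\<forall>v\<in>{v. t v \<noteq> 0}. h v \<le> 0)"
  shows "wsum t h \<le> 0 \<longleftrightarrow> (\<forall>v\<in>{v. t v \<noteq> 0}. h v \<le> 0)"
proof -
  have nn: "0 \<le> t v" for v using assms(1) by (simp add: weights_def)
  show ?thesis
  proof (cases "\<forall>v\<in>{v. t v \<noteq> 0}. h v \<le> 0")
    case True
    then have "wsum t h \<le> 0"
      unfolding wsum_def using nn by (intro sum_nonpos) (auto intro: mult_nonneg_nonpos)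
    with True show ?thesis by simp
  next
    case False
    then have "\<forall>v\<in>{v. t v \<noteq> 0}. 0 \<le> h v" using assms(2) by blast
    then have "wsum t h \<ge> 0"
      unfolding wsum_def using nn by (intro sum_nonneg) auto
    moreover have "wsum t h \<noteq> 0" using wsum_zero_iff[OF assms] False by auto
    ultimately show ?thesis using False by auto
  qed
qed

lemma wsum_const: "t \<in> weights \<Longrightarrow> wsum t (\<lambda>_. c) = c"
  by (simp add: wsum_def weights_def flip: sum_distrib_right)

lemma wsum_diff: "wsum t (\<lambda>v. g v - h v) = wsum t g - wsum t h"
  by (simp add: wsum_def right_diff_distrib sum_subtractf)

lemma wsum_minus: "wsum t (\<lambda>v. - h v) = - wsum t h"
  by (simp add: wsum_def sum_negf)

section \<open>The subcomplex cut out by the walls\<close>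

locale staircase =
  fixes S :: nat and \<rho> :: "nat \<Rightarrow> nat"
  assumes S_pos: "0 < S"
    and \<rho>_pos: "0 < \<rho> s"
    and \<rho>_mono: "\<rho> s \<le> \<rho> (Suc s)"
    and \<rho>_step: "\<rho> (Suc s) \<le> Suc (\<rho> s)"
begin

lemma mono_\<rho>: "s \<le> s' \<Longrightarrow> \<rho> s \<le> \<rho> s'"
  using \<rho>_mono by (rule lift_Suc_mono_le)

text \<open>One function per face of the body, nonpositive on its lattice points. They are given at
  vertices only and extended over simplices by \<open>wsum\<close>, so the stepped wall is described
  by \<open>\<rho>\<close> alone.\<close>

definition walls :: "(nat \<Rightarrow> real) set" where
  "walls = {\<lambda>v. - real (crd v 0), \<lambda>v. real (crd v 0) - real (\<rho> (crd v 1)),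
     \<lambda>v. - real (crd v 1), \<lambda>v. real (crd v 1) - real S,
     \<lambda>v. - real (crd v 2), \<lambda>v. real (crd v 2) - 1}"

definition cpx :: "nat set set" where
  "cpx = {\<sigma>. kuhn \<sigma> \<and> (\<forall>h\<in>walls. \<forall>v\<in>\<sigma>. h v \<le> 0) \<and> (\<exists>h\<in>walls. \<forall>v\<in>\<sigma>. h v = 0)}"

definition vset :: "nat set" where
  "vset = {v. crd v 0 \<le> \<rho> (crd v 1) \<and> crd v 1 \<le> S \<and> crd v 2 \<le> 1}"

lemma vset_iff: "v \<in> vset \<longleftrightarrow> (\<forall>h\<in>walls. h v \<le> 0)"
  by (auto simp: vset_def walls_def)

lemma finite_vset: "finite vset"
proof -
  have "v \<in> (\<lambda>(x, y, z). vtx x y z) ` ({..\<rho> S} \<times> {..S} \<times> {..1})" if "v \<in> vset" for v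
  proof -
    have "crd v 0 \<le> \<rho> S" using that mono_\<rho>[of "crd v 1" S] by (simp add: vset_def)
    then have "(crd v 0, crd v 1, crd v 2) \<in> {..\<rho> S} \<times> {..S} \<times> {..1}"
      using that by (auto simp: vset_def)
    then show ?thesis by (rule rev_image_eqI) (simp add: vtx_crd[unfolded One_nat_def])
  qed
  then have "vset \<subseteq> (\<lambda>(x, y, z). vtx x y z) ` ({..\<rho> S} \<times> {..S} \<times> {..1})" by blast
  then show ?thesis by (rule finite_subset) simp
qed

lemma cpx_subset: "\<sigma> \<in> cpx \<Longrightarrow> \<sigma> \<subseteq> vset"
  by (auto simp: cpx_def vset_iff)

lemma simplicial_cpx: "simplicial_cpx cpx"
proof -
  have "finite cpx"
    using finite_subset[of cpx "Pow vset"] cpx_subset finite_vset by auto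
  moreover have "kuhn \<tau>" if "kuhn \<sigma>" "\<tau> \<subseteq> \<sigma>" "\<tau> \<noteq> {}" for \<sigma> \<tau>
    using that unfolding kuhn_def by (meson finite_subset subsetD)
  then have "\<tau> \<in> cpx" if "\<sigma> \<in> cpx" "\<tau> \<subseteq> \<sigma>" "\<tau> \<noteq> {}" for \<sigma> \<tau>
    using that unfolding cpx_def by (smt (verit, best) mem_Collect_eq subsetD)
  moreover have "finite \<sigma> \<and> \<sigma> \<noteq> {}" if "\<sigma> \<in> cpx" for \<sigma>
    using that by (simp add: cpx_def kuhn_def)
  ultimately show ?thesis
    unfolding simplicial_cpx_def by blast
qed

text \<open>Along a chain in a unit cube the first coordinate and \<open>\<rho>\<close> of the
  second move in the same direction, each by at most 1, so their difference changes by at most 1, as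
  do single coordinates. An integer changing by at most 1 cannot pass from negative to
  positive.\<close>

lemma wall_same_sign:
  assumes \<sigma>: "kuhn \<sigma>" and h: "h \<in> walls"
  shows "(\<forall>v\<in>\<sigma>. 0 \<le> h v) \<or> (\<forall>v\<in>\<sigma>. h v \<le> 0)"
proof (rule ccontr)
  assume "\<not> ?thesis"
  then obtain u v where uv: "u \<in> \<sigma>" "v \<in> \<sigma>" "h u < 0" "0 < h v" by (auto simp: not_le)
  then have "(crd u 0 \<le> crd v 0 \<and> crd v 0 \<le> Suc (crd u 0) \<and> crd u 1 \<le> crd v 1 \<and> crd v 1 \<le> Suc (crd u 1)
      \<and> crd u 2 \<le> crd v 2 \<and> crd v 2 \<le> Suc (crd u 2)) \<or>
    (crd v 0 \<le> crd u 0 \<and> crd u 0 \<le> Suc (crd v 0) \<and> crd v 1 \<le> crd u 1 \<and> crd u 1 \<le> Suc (crd v 1)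
      \<and> crd v 2 \<le> crd u 2 \<and> crd u 2 \<le> Suc (crd v 2))"
    using \<sigma> by (auto simp: kuhn_def le1_def less_3_iff)
  moreover have "\<rho> (crd u 1) \<le> \<rho> (crd v 1)" if "crd u 1 \<le> crd v 1" using mono_\<rho>[OF that] .
  moreover have "\<rho> (crd u 1) \<le> Suc (\<rho> (crd v 1))" if "crd v 1 \<le> crd u 1" "crd u 1 \<le> Suc (crd v 1)"
    using that \<rho>_step[of "crd v 1"] by (cases "crd u 1 = crd v 1") (auto simp: le_Suc_eq)
  ultimately show False
    using h uv(3,4) by (auto simp: walls_def)
qed

lemma realization_cpx:
  "realization cpx = {t \<in> weights. (\<forall>h\<in>walls. wsum t h \<le> 0) \<and> (\<exists>h\<in>walls. wsum t h = 0)}"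
proof -
  have "t \<in> realization cpx \<longleftrightarrow> t \<in> weights \<and> (\<forall>h\<in>walls. wsum t h \<le> 0) \<and> (\<exists>h\<in>walls. wsum t h = 0)" for t
  proof (cases "t \<in> weights")
    case True
    then have k: "kuhn {v. t v \<noteq> 0}" by (simp add: weights_def)
    have "wsum t h \<le> 0 \<longleftrightarrow> (\<forall>v\<in>{v. t v \<noteq> 0}. h v \<le> 0)" "wsum t h = 0 \<longleftrightarrow> (\<forall>v\<in>{v. t v \<noteq> 0}. h v = 0)"
      if "h \<in> walls" for h
      using wsum_nonpos_iff[OF True wall_same_sign[OF k that]] wsum_zero_iff[OF True wall_same_sign[OF k that]] .
    then have "(\<forall>h\<in>walls. wsum t h \<le> 0) \<and> (\<exists>h\<in>walls. wsum t h = 0) \<longleftrightarrow> {v. t v \<noteq> 0} \<in> cpx"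
      unfolding cpx_def using k by (simp cong: ball_cong bex_cong)
    then show ?thesis using True by (simp add: realization_def weights_def)
  next
    case False
    then show ?thesis by (auto simp: realization_def weights_def cpx_def)
  qed
  then show ?thesis by blast
qed

text \<open>The piecewise linear interpolation of \<open>\<rho>\<close>, constant beyond 0 and
  \<open>S\<close>. Writing it with clamped increments gives continuity and positivity on the whole
  line without cases.\<close>

definition width :: "real \<Rightarrow> real" where
  "width y = real (\<rho> 0) + (\<Sum>k<S. (real (\<rho> (Suc k)) - real (\<rho> k)) * max 0 (min 1 (y - real k)))"

lemma continuous_width: "continuous_on T width"
  unfolding width_def by (intro continuous_intros)

lemma width_pos: "0 < width y"
  unfolding width_def using \<rho>_pos \<rho>_mono by (intro add_pos_nonneg sum_nonneg) auto

lemma width_interp: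
  assumes "b < S" "0 \<le> u" "u \<le> 1"
  shows "width (real b + u) = real (\<rho> b) + u * (real (\<rho> (Suc b)) - real (\<rho> b))"
proof -
  let ?g = "\<lambda>k. (real (\<rho> (Suc k)) - real (\<rho> k)) * max 0 (min 1 (real b + u - real k))"
  have "(\<Sum>k<S. ?g k) = (\<Sum>k<Suc b. ?g k)"
    using assms by (intro sum.mono_neutral_right) auto
  also have "\<dots> = (\<Sum>k<b. real (\<rho> (Suc k)) - real (\<rho> k)) + ?g b"
    using assms by (auto intro!: sum.cong)
  also have "(\<Sum>k<b. real (\<rho> (Suc k)) - real (\<rho> k)) = real (\<rho> b) - real (\<rho> 0)"
    by (rule sum_lessThan_telescope)
  finally show ?thesis
    using assms by (simp add: width_def)
qed

text \<open>A simplex lies between two consecutive rows \<open>b\<close> and \<open>Suc b\<close>,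
  where \<open>width\<close> is affine.\<close>

lemma wsum_\<rho>:
  assumes t: "t \<in> weights" and le: "\<And>v. t v \<noteq> 0 \<Longrightarrow> crd v 1 \<le> S"
  shows "wsum t (\<lambda>v. real (\<rho> (crd v 1))) = width (bary t 1)"
proof -
  define \<sigma> where "\<sigma> = {v. t v \<noteq> 0}"
  have k: "kuhn \<sigma>" and nn: "\<And>v. 0 \<le> t v" and one: "sum t \<sigma> = 1"
    using t by (auto simp: weights_def \<sigma>_def)
  have fin: "finite \<sigma>" "\<sigma> \<noteq> {}" using k by (auto simp: kuhn_def)
  define c where "c = Min ((\<lambda>v. crd v 1) ` \<sigma>)"
  have "c \<in> (\<lambda>v. crd v 1) ` \<sigma>" unfolding c_def using fin by (intro Min_in) auto
  then obtain v0 where v0: "v0 \<in> \<sigma>" "crd v0 1 = c" by auto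
  have c: "c \<le> crd v 1" "crd v 1 \<le> Suc c" if "v \<in> \<sigma>" for v
  proof -
    show "c \<le> crd v 1" unfolding c_def using fin that by (intro Min_le) auto
    then show "crd v 1 \<le> Suc c"
      using k v0 that unfolding kuhn_def le1_def by (metis le_SucI less_3_iff)
  qed
  \<comment> \<open>\<open>width_interp\<close> wants \<open>b < S\<close>, so a simplex inside the
    last row \<open>S\<close> is assigned to the layer below it.\<close>
  obtain b where b: "b < S" "\<And>v. v \<in> \<sigma> \<Longrightarrow> b \<le> crd v 1" "\<And>v. v \<in> \<sigma> \<Longrightarrow> crd v 1 \<le> Suc b"
  proof (cases "c < S")
    case True
    then show ?thesis using that[of c] c by blast
  next
    case False
    then have "crd v 1 = S" if "v \<in> \<sigma>" for v
      using le[of v] c(1)[OF that] that by (simp add: \<sigma>_def)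
    then show ?thesis using that[of "S - 1"] S_pos by auto
  qed
  define u where "u = wsum t (\<lambda>v. real (crd v 1) - real b)"
  have "0 \<le> u" unfolding u_def wsum_def using b(2) nn by (intro sum_nonneg) (auto simp: \<sigma>_def)
  have "u \<le> wsum t (\<lambda>v. 1)"
    unfolding u_def wsum_def using b(3) nn
    by (intro sum_mono mult_left_mono) (auto simp: \<sigma>_def of_nat_diff algebra_simps simp flip: of_nat_Suc)
  then have "u \<le> 1" using wsum_const[OF t] by simp
  have "bary t 1 = real b + u"
    unfolding u_def wsum_diff wsum_const[OF t] bary_def by simp
  moreover have "wsum t (\<lambda>v. real (\<rho> (crd v 1))) =
    wsum t (\<lambda>v. real (\<rho> b) + (real (crd v 1) - real b) * (real (\<rho> (Suc b)) - real (\<rho> b)))"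
    unfolding wsum_def
  proof (rule sum.cong[OF refl])
    fix v assume "v \<in> {v. t v \<noteq> 0}"
    then have "crd v 1 = b \<or> crd v 1 = Suc b" using b(2,3)[of v] by (auto simp: \<sigma>_def)
    then show "t v * real (\<rho> (crd v 1)) =
        t v * (real (\<rho> b) + (real (crd v 1) - real b) * (real (\<rho> (Suc b)) - real (\<rho> b)))" by auto
  qed
  moreover have "\<dots> = wsum t (\<lambda>_. real (\<rho> b)) + u * (real (\<rho> (Suc b)) - real (\<rho> b))"
    unfolding u_def wsum_def by (simp add: distrib_left sum.distrib sum_distrib_right mult.assoc)
  ultimately show ?thesis
    using width_interp[OF b(1) \<open>0 \<le> u\<close> \<open>u \<le> 1\<close>] wsum_const[OF t] by simp
qed

section \<open>The homeomorphism with the surface of a cube\<close>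

definition body_frontier :: "(nat \<Rightarrow> real) set" where
  "body_frontier = {p. 0 \<le> p 0 \<and> p 0 \<le> width (p 1) \<and> 0 \<le> p 1 \<and> p 1 \<le> real S \<and> 0 \<le> p 2 \<and> p 2 \<le> 1 \<and>
    (p 0 = 0 \<or> p 0 = width (p 1) \<or> p 1 = 0 \<or> p 1 = real S \<or> p 2 = 0 \<or> p 2 = 1)}"

lemma realization_iff_body_frontier:
  assumes t: "t \<in> weights"
  shows "t \<in> realization cpx \<longleftrightarrow> bary t \<in> body_frontier"
proof -
  have k: "kuhn {v. t v \<noteq> 0}" using t by (simp add: weights_def)
  have w: "wsum t (\<lambda>v. - real (crd v d)) = - bary t d" "wsum t (\<lambda>v. real (crd v d) - c) = bary t d - c" for d c
    by (simp_all add: bary_def wsum_minus wsum_diff wsum_const[OF t])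
  have S: "wsum t (\<lambda>v. real (crd v 0) - real (\<rho> (crd v 1))) = bary t 0 - width (bary t 1)"
    if "bary t 1 \<le> real S"
  proof -
    have h: "(\<lambda>v. real (crd v 1) - real S) \<in> walls" by (simp add: walls_def)
    have "wsum t (\<lambda>v. real (crd v 1) - real S) \<le> 0" using that w by simp
    then have "crd v 1 \<le> S" if "t v \<noteq> 0" for v
      using wsum_nonpos_iff[OF t wall_same_sign[OF k h]] that by auto
    then show ?thesis using wsum_\<rho>[OF t] by (simp add: wsum_diff bary_def)
  qed
  have "t \<in> realization cpx \<longleftrightarrow> (\<forall>h\<in>walls. wsum t h \<le> 0) \<and> (\<exists>h\<in>walls. wsum t h = 0)"
    using t by (simp add: realization_cpx)
  also have "\<dots> \<longleftrightarrow> bary t \<in> body_frontier"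
    using S by (cases "bary t 1 \<le> real S") (auto simp: walls_def w body_frontier_def)
  finally show ?thesis .
qed

definition to_cube :: "(nat \<Rightarrow> real) \<Rightarrow> real^3" where
  "to_cube t = (\<chi> i. if i = 1 then bary t 0 / width (bary t 1) else if i = 2 then bary t 1 / S else bary t 2)"

definition cube_coord :: "real^3 \<Rightarrow> nat \<Rightarrow> real" where
  "cube_coord q = (\<lambda>d. if d = 0 then q $ 1 * width (S * q $ 2) else if d = 1 then S * q $ 2 else q $ 3)"

definition cube_frontier :: "(real^3) set" where
  "cube_frontier = frontier (cbox 0 1)"

lemma cube_frontier_iff: "q \<in> cube_frontier \<longleftrightarrow> (\<forall>i. 0 \<le> q $ i \<and> q $ i \<le> 1) \<and> (\<exists>i. q $ i = 0 \<or> q $ i = 1)"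
proof -
  have "box 0 (1 :: real^3) \<noteq> {}" by (simp add: interval_ne_empty_cart)
  then show ?thesis
    by (simp add: cube_frontier_def frontier_cbox mem_box_cart) (metis less_le)
qed

lemma hat_cong: "(\<And>d. d < 3 \<Longrightarrow> p d = q d) \<Longrightarrow> hat p = hat q"
  by (auto simp: hat_def excess_def defect_def)

lemma realization_homeomorphic_cube: "realization cpx homeomorphic cube_frontier"
proof (rule homeomorphicI[where f = to_cube and g = "\<lambda>q. hat (cube_coord q)"])
  have ex3: "(\<exists>i::3. P i) \<longleftrightarrow> P 1 \<or> P 2 \<or> P 3" for P
    by (metis exhaust_3)
  have w: "0 < width y" "width y \<noteq> 0" for y using width_pos[of y] by auto
  have to_c: "to_cube t \<in> cube_frontier" "hat (cube_coord (to_cube t)) = t" if "t \<in> realization cpx" for t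
  proof -
    have t: "t \<in> weights" using that by (simp add: realization_cpx)
    then have b: "bary t \<in> body_frontier" using that realization_iff_body_frontier by blast
    then show "to_cube t \<in> cube_frontier"
      using w S_pos by (auto simp: cube_frontier_iff to_cube_def body_frontier_def forall_3 ex3 pos_divide_le_eq)
    have "cube_coord (to_cube t) d = bary t d" if "d < 3" for d
      using w S_pos that by (auto simp: cube_coord_def to_cube_def less_3_iff)
    then show "hat (cube_coord (to_cube t)) = t"
      using hat_cong hat_bary[OF t] by (metis ext)
  qed
  have from_c: "hat (cube_coord q) \<in> realization cpx" "to_cube (hat (cube_coord q)) = q" if q: "q \<in> cube_frontier" for q
  proof -
    have nn: "0 \<le> cube_coord q d" if "d < 3" for d
      using q w(1)[of "S * q $ 2"] by (auto simp: cube_coord_def cube_frontier_iff)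
    have t: "hat (cube_coord q) \<in> weights" and b: "\<And>d. d < 3 \<Longrightarrow> bary (hat (cube_coord q)) d = cube_coord q d"
      using hat_in_weights[of "cube_coord q"] nn by auto
    have b': "bary (hat (cube_coord q)) 0 = q $ 1 * width (S * q $ 2)"
      "bary (hat (cube_coord q)) 1 = S * q $ 2" "bary (hat (cube_coord q)) 2 = q $ 3"
      using b[of 0] b[of 1] b[of 2] by (auto simp: cube_coord_def)
    have "bary (hat (cube_coord q)) \<in> body_frontier"
      using q w(1)[of "S * q $ 2"] S_pos unfolding body_frontier_def mem_Collect_eq b'
      by (auto simp: cube_frontier_iff forall_3 ex3 mult_le_cancel_left1 mult_le_cancel_right1)
    then show "hat (cube_coord q) \<in> realization cpx"
      using realization_iff_body_frontier[OF t] by blast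
    show "to_cube (hat (cube_coord q)) = q"
      using w S_pos unfolding to_cube_def b' by (auto simp: vec_eq_iff forall_3)
  qed
  show "to_cube ` realization cpx = cube_frontier"
    using to_c(1) from_c by (metis (no_types, lifting) image_iff subsetI subset_antisym image_subsetI)
  show "(\<lambda>q. hat (cube_coord q)) ` cube_frontier = realization cpx"
    using to_c from_c by (metis (no_types, lifting) image_iff subsetI subset_antisym image_subsetI)
  show "hat (cube_coord (to_cube t)) = t" if "t \<in> realization cpx" for t
    using to_c that by blast
  show "to_cube (hat (cube_coord q)) = q" if "q \<in> cube_frontier" for q
    using from_c that by blast
  show "continuous_on cube_frontier (\<lambda>q. hat (cube_coord q))"
    unfolding cube_coord_def
    by (intro continuous_on_hat continuous_intros continuous_on_compose2[OF continuous_width]) auto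
  \<comment> \<open>The support varies with \<open>t\<close> but stays in the finite set
    \<open>vset\<close>, so on the realization \<open>bary\<close> is one fixed finite sum.\<close>
  have bary: "continuous_on (realization cpx) (\<lambda>t. bary t d)" for d
  proof -
    have "bary t d = (\<Sum>v\<in>vset. t v * real (crd v d))" if "t \<in> realization cpx" for t
      unfolding bary_def wsum_def using that cpx_subset finite_vset
      by (intro sum.mono_neutral_left) (auto simp: realization_def)
    moreover have "continuous_on (realization cpx) (\<lambda>t. \<Sum>v\<in>vset. t v * real (crd v d))"
      by (intro continuous_intros continuous_on_subset[OF continuous_on_product_coordinates]) auto
    ultimately show ?thesis by (simp cong: continuous_on_cong)
  qed
  have c1: "continuous_on (realization cpx) (\<lambda>t. bary t 0 / width (bary t 1))"
    using w by (intro continuous_intros bary continuous_on_compose2[OF continuous_width bary]) auto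
  have c2: "continuous_on (realization cpx) (\<lambda>t. bary t 1 / S)"
    using S_pos by (intro continuous_intros bary) auto
  have "continuous_on (realization cpx)
      (\<lambda>t. if i = 1 then bary t 0 / width (bary t 1) else if i = 2 then bary t 1 / S else bary t 2)" for i :: 3
    using c1 c2 bary by (cases "i = 1"; cases "i = 2") (simp_all del: One_nat_def)
  then show "continuous_on (realization cpx) to_cube"
    unfolding to_cube_def by (rule continuous_on_vec_lambda)
qed

lemma cube_homeomorphic_sphere: "cube_frontier homeomorphic (sphere 0 1 :: (real^3) set)"
proof -
  have ne: "interior (cbox 0 (1 :: real^3)) \<noteq> {}" by (simp add: interval_ne_empty_cart)
  have ne': "interior (cball 0 1 :: (real^3) set) \<noteq> {}" by simp
  have "rel_frontier (cbox 0 (1 :: real^3)) homeomorphic rel_frontier (cball 0 1 :: (real^3) set)"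
    by (rule homeomorphic_rel_frontiers_convex_bounded_sets)
      (use ne ne' in \<open>auto simp: aff_dim_nonempty_interior\<close>)
  then show ?thesis
    by (simp add: cube_frontier_def rel_frontier_nonempty_interior[OF ne] rel_frontier_nonempty_interior[OF ne'])
qed

lemma sphere_triangulation_cpx: "sphere_triangulation cpx"
  unfolding sphere_triangulation_def
  using simplicial_cpx homeomorphic_trans[OF realization_homeomorphic_cube cube_homeomorphic_sphere] by simp

end


section \<open>Degree, edges and vertex sums of the 1-skeleton\<close>

lemma card_kuhn_neighbours: "card {y. le1 x y \<or> le1 y x} \<le> 27" "finite {y. le1 x y \<or> le1 y x}"
proof -
  \<comment> \<open>Neighbours differ from \<open>x\<close> by at most 1 in each coordinate; at 0,
    truncated subtraction only shrinks the interval.\<close>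
  let ?I = "\<lambda>d. {crd x d - 1..crd x d + 1}"
  have I: "card (?I d) \<le> 3" for d by simp
  have "y \<in> (\<lambda>(a, b, c). vtx a b c) ` (?I 0 \<times> ?I 1 \<times> ?I 2)" if "le1 x y \<or> le1 y x" for y
  proof -
    have "(crd y 0, crd y 1, crd y 2) \<in> ?I 0 \<times> ?I 1 \<times> ?I 2"
      using that
    proof
      assume "le1 x y"
      then have "crd x d \<le> crd y d" "crd y d \<le> Suc (crd x d)" if "d < 3" for d
        using that by (simp_all add: le1_def)
      from this[of 0] this[of 1] this[of 2] show ?thesis by auto
    next
      assume "le1 y x"
      then have "crd y d \<le> crd x d" "crd x d \<le> Suc (crd y d)" if "d < 3" for d
        using that by (simp_all add: le1_def)
      from this[of 0] this[of 1] this[of 2] show ?thesis by auto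
    qed
    then show ?thesis by (rule rev_image_eqI) (simp add: vtx_crd[unfolded One_nat_def])
  qed
  then have sub: "{y. le1 x y \<or> le1 y x} \<subseteq> (\<lambda>(a, b, c). vtx a b c) ` (?I 0 \<times> ?I 1 \<times> ?I 2)" by blast
  then show "finite {y. le1 x y \<or> le1 y x}" by (rule finite_subset) simp
  have "card {y. le1 x y \<or> le1 y x} \<le> card (?I 0 \<times> ?I 1 \<times> ?I 2)"
    using sub by (intro surj_card_le) auto
  also have "\<dots> \<le> 3 * (3 * 3)"
    unfolding card_cartesian_product by (intro mult_le_mono I)
  finally show "card {y. le1 x y \<or> le1 y x} \<le> 27" by simp
qed

text \<open>Distinct ordered pairs are distinct terms of the double sum \<open>dirichlet\<close>,
  and its other terms are nonnegative.\<close>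

lemma (in finite_graph) dirichlet_ge_sum:
  assumes "finite J" and "inj_on (\<lambda>j. (p j, q j)) J" and "\<And>j. j \<in> J \<Longrightarrow> {p j, q j} \<in> edges G"
  shows "(\<Sum>j\<in>J. (f (p j) - f (q j))\<^sup>2) \<le> dirichlet G f"
proof -
  let ?A = "SIGMA x:verts G. {y. {x, y} \<in> edges G}"
  have "(\<lambda>j. (p j, q j)) ` J \<subseteq> ?A"
    using assms(3) edge_subset by fastforce
  then have "(\<Sum>(x, y)\<in>(\<lambda>j. (p j, q j)) ` J. (f x - f y)\<^sup>2) \<le> (\<Sum>(x, y)\<in>?A. (f x - f y)\<^sup>2)"
    using finite_verts finite_neighbours by (intro sum_mono2) auto
  then show ?thesis
    using assms(2) finite_verts finite_neighbours
    by (simp add: sum.reindex dirichlet_def sum.Sigma)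
qed

definition sheets :: "nat set" where
  "sheets = {0, 1}"

lemma mem_sheets_iff [simp]: "z \<in> sheets \<longleftrightarrow> z \<le> 1"
  by (auto simp: sheets_def)

lemma finite_sheets [simp]: "finite sheets" and card_sheets [simp]: "card sheets = 2"
  by (simp_all add: sheets_def)

context staircase
begin

abbreviation skel :: "nat graph" where
  "skel \<equiv> one_skeleton cpx"

lemma edge_iff:
  "{u, v} \<in> edges skel \<longleftrightarrow> u \<noteq> v \<and> (le1 u v \<or> le1 v u) \<and> u \<in> vset \<and> v \<in> vset \<and>
     (\<exists>h\<in>walls. h u = 0 \<and> h v = 0)"
proof -
  have "le1 w w" for w by (simp add: le1_def)
  then have "kuhn {u, v} \<longleftrightarrow> le1 u v \<or> le1 v u" by (auto simp: kuhn_def)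
  moreover have "card {u, v} = 2 \<longleftrightarrow> u \<noteq> v" by (cases "u = v") auto
  ultimately show ?thesis
    unfolding one_skeleton_def cpx_def vset_iff by auto
qed

text \<open>Thickness 1 puts every lattice point of the body on the face z = 0 or z = 1, so no
  vertex is interior.\<close>

lemma verts_skel: "verts skel = vset"
proof
  show "verts skel \<subseteq> vset" using cpx_subset by (auto simp: one_skeleton_def)
  show "vset \<subseteq> verts skel"
  proof
    fix v assume v: "v \<in> vset"
    then have "crd v 2 = 0 \<or> crd v 2 = 1" by (auto simp: vset_def)
    then have "\<exists>h\<in>walls. h v = 0" by (auto simp: walls_def)
    then have "{v} \<in> cpx"
      using v by (auto simp: cpx_def vset_iff kuhn_def le1_def)
    then show "v \<in> verts skel" by (auto simp: one_skeleton_def)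
  qed
qed

sublocale skel: finite_graph skel
proof
  show "finite (verts skel)" by (simp add: verts_skel finite_vset)
  show "e \<subseteq> verts skel" if "e \<in> edges skel" for e
    using that by (auto simp: one_skeleton_def)
qed

lemma degree_skel: "graph_degree skel \<le> 27"
proof -
  have "card {e \<in> edges skel. x \<in> e} \<le> 27" for x
  proof -
    have "e \<in> (\<lambda>y. {x, y}) ` {y. le1 x y \<or> le1 y x}" if "e \<in> edges skel" "x \<in> e" for e
    proof -
      obtain a b where "e = {a, b}"
        using \<open>e \<in> edges skel\<close> by (auto simp: one_skeleton_def card_2_iff)
      then have "e = {x, a} \<or> e = {x, b}" using \<open>x \<in> e\<close> by auto
      then obtain y where "e = {x, y}" by blast
      then show ?thesis using that edge_iff by blast
    qed
    then have "{e \<in> edges skel. x \<in> e} \<subseteq> (\<lambda>y. {x, y}) ` {y. le1 x y \<or> le1 y x}" by blast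
    then have "card {e \<in> edges skel. x \<in> e} \<le> card {y. le1 x y \<or> le1 y x}"
      using card_kuhn_neighbours(2) by (intro surj_card_le)
    then show ?thesis using card_kuhn_neighbours(1)[of x] by linarith
  qed
  moreover have "vtx 0 0 0 \<in> verts skel" by (simp add: verts_skel vset_def)
  ultimately show ?thesis
    unfolding graph_degree_def using skel.finite_verts by (subst Max_le_iff) auto
qed

lemma vtx_in_vset: "vtx i s z \<in> vset \<longleftrightarrow> i \<le> \<rho> s \<and> s \<le> S \<and> z \<le> 1"
  by (simp add: vset_def)

lemma sheet_wall: "z \<le> 1 \<Longrightarrow> \<exists>h\<in>walls. h (vtx i s z) = 0 \<and> h (vtx i' s' z) = 0"
  by (cases "z = 0") (auto simp: walls_def)

lemma le1_vtx: "le1 (vtx i s z) (vtx i' s' z') \<longleftrightarrow>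
    i \<le> i' \<and> i' \<le> Suc i \<and> s \<le> s' \<and> s' \<le> Suc s \<and> z \<le> z' \<and> z' \<le> Suc z"
  by (auto simp: le1_def less_3_iff)

lemma edge_horizontal:
  "i < \<rho> s \<Longrightarrow> s \<le> S \<Longrightarrow> z \<le> 1 \<Longrightarrow> {vtx i s z, vtx (Suc i) s z} \<in> edges skel"
  unfolding edge_iff using sheet_wall by (simp add: le1_vtx vtx_in_vset)

lemma edge_vertical:
  "i \<le> \<rho> s \<Longrightarrow> s < S \<Longrightarrow> z \<le> 1 \<Longrightarrow> {vtx i s z, vtx i (Suc s) z} \<in> edges skel"
  unfolding edge_iff using sheet_wall \<rho>_mono[of s] by (simp add: le1_vtx vtx_in_vset)

lemma edge_diagonal:
  "i \<le> \<rho> s \<Longrightarrow> Suc i \<le> \<rho> (Suc s) \<Longrightarrow> s < S \<Longrightarrow> z \<le> 1 \<Longrightarrow> {vtx i s z, vtx (Suc i) (Suc s) z} \<in> edges skel"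
  unfolding edge_iff using sheet_wall by (simp add: le1_vtx vtx_in_vset)

text \<open>These edges of the wall x = 0 are the only links between the two sheets that the
  estimates use.\<close>

lemma edge_rim: "s \<le> S \<Longrightarrow> {vtx 0 s 0, vtx 0 s 1} \<in> edges skel"
  unfolding edge_iff by (auto simp: le1_vtx vtx_in_vset walls_def)

lemma edge_height: "{u, v} \<in> edges skel \<Longrightarrow> crd v 1 \<le> Suc (crd u 1)"
  unfolding edge_iff le1_def less_3_iff by auto

lemma sum_vset:
  fixes h :: "nat \<Rightarrow> real"
  shows "(\<Sum>v\<in>vset. h v) = (\<Sum>s\<le>S. \<Sum>(i, z)\<in>{..\<rho> s} \<times> sheets. h (vtx i s z))"
proof -
  let ?J = "SIGMA s:{..S}. {..\<rho> s} \<times> sheets"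
  let ?e = "\<lambda>(s, i, z). vtx i s z"
  have "inj_on ?e ?J" by (auto simp: inj_on_def)
  moreover have "?e ` ?J = vset"
  proof
    show "?e ` ?J \<subseteq> vset" by (auto simp: vtx_in_vset)
    show "vset \<subseteq> ?e ` ?J"
    proof
      fix v assume "v \<in> vset"
      then have "(crd v 1, crd v 0, crd v 2) \<in> ?J" by (auto simp: vset_def)
      then show "v \<in> ?e ` ?J" by (rule rev_image_eqI) (simp add: vtx_crd[unfolded One_nat_def])
    qed
  qed
  ultimately have "(\<Sum>v\<in>vset. h v) = (\<Sum>j\<in>?J. h (?e j))"
    by (metis (no_types, lifting) sum.reindex_cong)
  also have "\<dots> = (\<Sum>s\<le>S. \<Sum>(i, z)\<in>{..\<rho> s} \<times> sheets. h (vtx i s z))"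
    by (subst sum.Sigma) (auto intro!: sum.cong)
  finally show ?thesis .
qed

lemma card_vset_ge: "S < card vset"
proof -
  have "card ((\<lambda>s. vtx 0 s 0) ` {..S}) \<le> card vset"
    by (intro card_mono finite_vset) (auto simp: vtx_in_vset)
  then show ?thesis by (simp add: card_image inj_on_def)
qed

end


section \<open>The Poincare inequality\<close>

lemma sum_blocks:
  fixes h :: "nat \<Rightarrow> real"
  assumes "0 < m"
  shows "(\<Sum>t<K * m. h (t div m)) = real m * (\<Sum>k<K. h k)"
proof (induction K)
  case (Suc K)
  have "(\<Sum>t<Suc K * m. h (t div m)) = (\<Sum>t<K * m. h (t div m)) + (\<Sum>t\<in>{K * m..<K * m + m}. h (t div m))"
    using sum.atLeastLessThan_concat[of 0 "K * m" "K * m + m" "\<lambda>t. h (t div m)"]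
    by (simp add: atLeast0LessThan add.commute)
  also have "(\<Sum>t\<in>{K * m..<K * m + m}. h (t div m)) = (\<Sum>t\<in>{K * m..<K * m + m}. h K)"
  proof (rule sum.cong[OF refl])
    fix t assume "t \<in> {K * m..<K * m + m}"
    then have "t div m = K" by (intro div_nat_eqI) (auto simp: mult.commute)
    then show "h (t div m) = h K" by simp
  qed
  finally show ?case using Suc.IH by (simp add: distrib_left)
qed simp

lemma sum_half_powers: "(\<Sum>k\<in>{a..<b}. 1 / 2 ^ k) \<le> (2::real) / 2 ^ a"
proof (cases "a \<le> b")
  case True
  then have "(\<Sum>k\<in>{a..<b}. 1 / 2 ^ k) = (2::real) / 2 ^ a - 2 / 2 ^ b"
  proof (induction b rule: dec_induct)
    case (step n)
    then show ?case by (simp add: add_divide_distrib[symmetric])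
  qed simp
  then show ?thesis by simp
qed simp

text \<open>A discrete Hardy inequality. The auxiliary weight \<open>u\<close> in the Cauchy-Schwarz step grows like the
  square root of \<open>N\<close>, which makes both resulting sums geometric over blocks of length \<open>m\<close>.\<close>

lemma hardy:
  fixes a e N :: "nat \<Rightarrow> real" and m K :: nat
  defines "T \<equiv> K * m"
  assumes m: "0 < m"
    and nn: "\<And>s. 0 \<le> a s" "\<And>s. 0 \<le> e s"
    and N: "\<And>s. s < T \<Longrightarrow> 4 ^ (s div m) \<le> N s" "\<And>s. s < T \<Longrightarrow> N s \<le> 5 * 4 ^ (s div m)" "4 ^ K \<le> N T"
    and step: "\<And>s. s < T \<Longrightarrow> a s / sqrt (N s) \<le> a (Suc s) / sqrt (N (Suc s)) + e s / sqrt (N s)"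
  shows "(\<Sum>s<T. (a s)\<^sup>2) \<le> 4 * real m * (a T)\<^sup>2 + 40 * (real m)\<^sup>2 * (\<Sum>s<T. (e s)\<^sup>2)"
proof -
  define u :: "nat \<Rightarrow> real" where "u s = 2 ^ (s div m)" for s
  define b where "b s = a s / sqrt (N s)" for s
  define \<epsilon> where "\<epsilon> s = e s / sqrt (N s)" for s
  have N_pos: "0 < N s" if "s < T" for s using N(1)[OF that] by (smt (verit) zero_less_power)
  have NT_pos: "0 < N T" using N(3) by (smt (verit) zero_less_power)
  have u_pos: "0 < u s" for s by (simp add: u_def)
  have u_sq: "(u s)\<^sup>2 = 4 ^ (s div m)" for s
    by (simp add: u_def flip: power_mult_distrib power2_eq_square) (simp add: power2_eq_square flip: power_mult_distrib)
  have b_nn: "0 \<le> b s" if "s < T" for s using nn N_pos[OF that] by (simp add: b_def)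
  have \<epsilon>_sq: "(\<epsilon> s)\<^sup>2 = (e s)\<^sup>2 / N s" if "s < T" for s
    using N_pos[OF that] by (simp add: \<epsilon>_def power_divide)
  have b_le: "b s \<le> b T + (\<Sum>t\<in>{s..<T}. \<epsilon> t)" if "s \<le> T" for s
    using that
  proof (induction rule: inc_induct)
    case (step n)
    have "(\<Sum>t\<in>{n..<T}. \<epsilon> t) = \<epsilon> n + (\<Sum>t\<in>{Suc n..<T}. \<epsilon> t)"
      using step by (simp add: sum.atLeast_Suc_lessThan)
    then show ?case using step assms(8)[of n] by (simp add: b_def \<epsilon>_def)
  qed simp
  have tail: "(\<Sum>t\<in>{s..<T}. 1 / u t) \<le> 2 * real m / u s" for s
  proof -
    \<comment> \<open>Extended by zero on earlier blocks, so that the partial sum is completed to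
      whole blocks.\<close>
    define h :: "nat \<Rightarrow> real" where "h k = (if s div m \<le> k then 1 / 2 ^ k else 0)" for k
    have "(\<Sum>t\<in>{s..<T}. 1 / u t) = (\<Sum>t\<in>{s..<T}. h (t div m))"
      by (intro sum.cong) (auto simp: h_def u_def div_le_mono)
    also have "\<dots> \<le> (\<Sum>t<T. h (t div m))"
      by (intro sum_mono2) (auto simp: h_def)
    also have "\<dots> = real m * (\<Sum>k<K. h k)" unfolding T_def by (rule sum_blocks[OF m])
    also have "(\<Sum>k<K. h k) = (\<Sum>k\<in>{s div m..<K}. 1 / 2 ^ k)"
      unfolding h_def by (intro sum.mono_neutral_cong_right) auto
    also have "real m * \<dots> \<le> real m * (2 / 2 ^ (s div m))"
      by (intro mult_left_mono sum_half_powers) auto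
    finally show ?thesis by (simp add: u_def mult.commute)
  qed
  have head: "(\<Sum>s\<le>t. N s / u s) \<le> 10 * real m * u t" if "t < T" for t
  proof -
    define h :: "nat \<Rightarrow> real" where "h k = (if k \<le> t div m then 5 * 2 ^ k else 0)" for k
    have "(\<Sum>s\<le>t. N s / u s) \<le> (\<Sum>s\<le>t. h (s div m))"
    proof (rule sum_mono)
      fix s assume "s \<in> {..t}"
      then have "s \<le> t" "s < T" using that by auto
      have "N s / u s \<le> 5 * (u s)\<^sup>2 / u s"
        unfolding u_sq using N(2)[OF \<open>s < T\<close>] u_pos[of s] by (intro divide_right_mono) auto
      also have "\<dots> = 5 * u s" using u_pos[of s] by (simp add: power2_eq_square)
      also have "\<dots> = h (s div m)" using \<open>s \<le> t\<close> by (simp add: h_def u_def div_le_mono)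
      finally show "N s / u s \<le> h (s div m)" .
    qed
    also have "\<dots> \<le> (\<Sum>s<T. h (s div m))"
      using that by (intro sum_mono2) (auto simp: h_def)
    also have "\<dots> = real m * (\<Sum>k<K. h k)" unfolding T_def by (rule sum_blocks[OF m])
    also have "(\<Sum>k<K. h k) \<le> (\<Sum>k\<le>t div m. 5 * 2 ^ k)"
    proof -
      have "(\<Sum>k<K. h k) = (\<Sum>k\<in>{..<K} \<inter> {..t div m}. 5 * 2 ^ k)"
        unfolding h_def by (intro sum.mono_neutral_cong_right) auto
      also have "\<dots> \<le> (\<Sum>k\<le>t div m. 5 * 2 ^ k)" by (intro sum_mono2) auto
      finally show ?thesis .
    qed
    also have "(\<Sum>k\<le>t div m. 5 * 2 ^ k) \<le> 10 * (2 :: real) ^ (t div m)"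
    proof -
      have "(\<Sum>k\<le>n. 5 * 2 ^ k) \<le> 10 * (2 :: real) ^ n" for n by (induction n) auto
      then show ?thesis .
    qed
    finally show ?thesis by (simp add: u_def mult_left_mono)
  qed
  have "(\<Sum>s<T. N s) \<le> (\<Sum>s<T. 5 * 4 ^ (s div m))" using N(2) by (intro sum_mono) auto
  also have "\<dots> = real m * (\<Sum>k<K. 5 * 4 ^ k)" unfolding T_def by (rule sum_blocks[OF m])
  also have "\<dots> \<le> real m * (2 * N T)"
  proof (rule mult_left_mono)
    have "(\<Sum>k<K. 5 * 4 ^ k) \<le> 5 / 3 * (4::real) ^ K" by (induction K) auto
    also have "\<dots> \<le> 2 * 4 ^ K" by simp
    finally show "(\<Sum>k<K. 5 * 4 ^ k) \<le> 2 * N T" using N(3) by simp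
  qed simp
  finally have sumN: "(\<Sum>s<T. N s) \<le> 2 * real m * N T" by (simp add: mult_ac)
  have CS: "(\<Sum>t\<in>{s..<T}. \<epsilon> t)\<^sup>2 \<le> (\<Sum>t\<in>{s..<T}. (\<epsilon> t)\<^sup>2 * u t) * (2 * real m / u s)" for s
  proof -
    have "(\<Sum>t\<in>{s..<T}. \<epsilon> t)\<^sup>2 = (\<Sum>t\<in>{s..<T}. (\<epsilon> t * sqrt (u t)) * (1 / sqrt (u t)))\<^sup>2"
      using u_pos by (simp add: less_imp_neq[symmetric])
    also have "\<dots> \<le> (\<Sum>t\<in>{s..<T}. (\<epsilon> t * sqrt (u t))\<^sup>2) * (\<Sum>t\<in>{s..<T}. (1 / sqrt (u t))\<^sup>2)"
      by (rule Cauchy_Schwarz_ineq_sum)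
    also have "\<dots> = (\<Sum>t\<in>{s..<T}. (\<epsilon> t)\<^sup>2 * u t) * (\<Sum>t\<in>{s..<T}. 1 / u t)"
      using u_pos by (simp add: power_mult_distrib power_divide less_imp_le)
    also have "\<dots> \<le> (\<Sum>t\<in>{s..<T}. (\<epsilon> t)\<^sup>2 * u t) * (2 * real m / u s)"
      using u_pos by (intro mult_left_mono tail sum_nonneg) (auto simp: less_imp_le)
    finally show ?thesis .
  qed
  have "(\<Sum>s<T. (a s)\<^sup>2) \<le> (\<Sum>s<T. 2 * (b T)\<^sup>2 * N s + 2 * (N s * (\<Sum>t\<in>{s..<T}. \<epsilon> t)\<^sup>2))"
  proof (rule sum_mono)
    fix s assume "s \<in> {..<T}"
    then have s: "s < T" by simp
    have "(b s)\<^sup>2 \<le> (b T + (\<Sum>t\<in>{s..<T}. \<epsilon> t))\<^sup>2"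
      using b_le[of s] b_nn[of s] s by (intro power_mono) auto
    also have "\<dots> \<le> 2 * (b T)\<^sup>2 + 2 * (\<Sum>t\<in>{s..<T}. \<epsilon> t)\<^sup>2"
      using sum_squares_bound[of "b T" "\<Sum>t\<in>{s..<T}. \<epsilon> t"] by (simp add: power2_sum)
    finally have "N s * (b s)\<^sup>2 \<le> N s * (2 * (b T)\<^sup>2 + 2 * (\<Sum>t\<in>{s..<T}. \<epsilon> t)\<^sup>2)"
      using N_pos[OF s] by (intro mult_left_mono) auto
    moreover have "N s * (b s)\<^sup>2 = (a s)\<^sup>2" using N_pos[OF s] by (simp add: b_def power_divide)
    ultimately show "(a s)\<^sup>2 \<le> 2 * (b T)\<^sup>2 * N s + 2 * (N s * (\<Sum>t\<in>{s..<T}. \<epsilon> t)\<^sup>2)"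
      by (simp add: algebra_simps)
  qed
  also have "\<dots> = 2 * (b T)\<^sup>2 * (\<Sum>s<T. N s) + 2 * (\<Sum>s<T. N s * (\<Sum>t\<in>{s..<T}. \<epsilon> t)\<^sup>2)"
    by (simp add: sum.distrib sum_distrib_left)
  also have "2 * (b T)\<^sup>2 * (\<Sum>s<T. N s) \<le> 2 * (b T)\<^sup>2 * (2 * real m * N T)"
    using sumN by (intro mult_left_mono) auto
  also have "2 * (b T)\<^sup>2 * (2 * real m * N T) = 4 * real m * (a T)\<^sup>2"
    using NT_pos by (simp add: b_def power_divide)
  also have "(\<Sum>s<T. N s * (\<Sum>t\<in>{s..<T}. \<epsilon> t)\<^sup>2) \<le> (\<Sum>s<T. \<Sum>t\<in>{s..<T}. 2 * real m * ((\<epsilon> t)\<^sup>2 * u t) * (N s / u s))"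
  proof (rule sum_mono)
    fix s assume "s \<in> {..<T}"
    then have "N s * (\<Sum>t\<in>{s..<T}. \<epsilon> t)\<^sup>2 \<le> N s * ((\<Sum>t\<in>{s..<T}. (\<epsilon> t)\<^sup>2 * u t) * (2 * real m / u s))"
      using N_pos[of s] CS[of s] by (intro mult_left_mono) auto
    also have "\<dots> = (\<Sum>t\<in>{s..<T}. 2 * real m * ((\<epsilon> t)\<^sup>2 * u t) * (N s / u s))"
      by (simp add: sum_distrib_left sum_distrib_right mult_ac)
    finally show "N s * (\<Sum>t\<in>{s..<T}. \<epsilon> t)\<^sup>2 \<le> (\<Sum>t\<in>{s..<T}. 2 * real m * ((\<epsilon> t)\<^sup>2 * u t) * (N s / u s))" .
  qed
  \<comment> \<open>Exchanging the sums gives each \<open>e t\<close> a factor bounded by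
    \<open>head\<close>. The constant 40 is 2 * 2 * 10: from squaring a sum of two terms, from
    \<open>tail\<close> and from \<open>head\<close>.\<close>
  also have "\<dots> = (\<Sum>t<T. \<Sum>s\<le>t. 2 * real m * ((\<epsilon> t)\<^sup>2 * u t) * (N s / u s))"
    unfolding sum.Sigma[OF finite_lessThan ballI[OF finite_atLeastLessThan]] sum.Sigma[OF finite_lessThan ballI[OF finite_atMost]]
    by (rule sum.reindex_bij_witness[where i = prod.swap and j = prod.swap]) auto
  also have "\<dots> \<le> (\<Sum>t<T. 20 * (real m)\<^sup>2 * (e t)\<^sup>2)"
  proof (rule sum_mono)
    fix t assume "t \<in> {..<T}"
    then have t: "t < T" by simp
    have "(\<Sum>s\<le>t. 2 * real m * ((\<epsilon> t)\<^sup>2 * u t) * (N s / u s)) = 2 * real m * ((\<epsilon> t)\<^sup>2 * u t) * (\<Sum>s\<le>t. N s / u s)"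
      by (simp add: sum_distrib_left)
    also have "\<dots> \<le> 2 * real m * ((\<epsilon> t)\<^sup>2 * u t) * (10 * real m * u t)"
      using u_pos[of t] head[OF t] by (intro mult_left_mono) auto
    also have "\<dots> = 20 * (real m)\<^sup>2 * ((e t)\<^sup>2 * ((u t)\<^sup>2 / N t))"
      unfolding \<epsilon>_sq[OF t] by (simp add: power2_eq_square)
    \<comment> \<open>\<open>(u t)\<^sup>2\<close> is exactly the lower bound assumed for
      \<open>N t\<close>, so the auxiliary weight disappears.\<close>
    also have "\<dots> \<le> 20 * (real m)\<^sup>2 * ((e t)\<^sup>2 * 1)"
      using N(1)[OF t] N_pos[OF t] by (intro mult_left_mono) (auto simp: u_sq)
    finally show "(\<Sum>s\<le>t. 2 * real m * ((\<epsilon> t)\<^sup>2 * u t) * (N s / u s)) \<le> 20 * (real m)\<^sup>2 * (e t)\<^sup>2" by simp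
  qed
  finally show ?thesis by (simp add: sum_distrib_left mult.assoc)
qed

section \<open>Averaging a row onto a shorter one\<close>

lemma convex_square:
  fixes x y :: real
  assumes "0 \<le> \<alpha>" "\<alpha> \<le> 1"
  shows "((1 - \<alpha>) * x + \<alpha> * y)\<^sup>2 \<le> (1 - \<alpha>) * x\<^sup>2 + \<alpha> * y\<^sup>2"
proof -
  have "(1 - \<alpha>) * x\<^sup>2 + \<alpha> * y\<^sup>2 - ((1 - \<alpha>) * x + \<alpha> * y)\<^sup>2 = \<alpha> * (1 - \<alpha>) * (x - y)\<^sup>2"
    by (simp add: power2_eq_square algebra_simps)
  moreover have "0 \<le> \<alpha> * (1 - \<alpha>) * (x - y)\<^sup>2" using assms by simp
  ultimately show ?thesis by simp
qed

text \<open>The averaging from a row of \<open>w + 2\<close> points to a row of \<open>w + 1\<close> points whose weights add up to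
  the same total over every point of the longer row.\<close>

definition shrink :: "nat \<Rightarrow> (nat \<Rightarrow> real) \<Rightarrow> nat \<Rightarrow> real" where
  "shrink w v i = (1 - (real i + 1) / (real w + 2)) * v i + (real i + 1) / (real w + 2) * v (Suc i)"

text \<open>Convexity of the square, term by term. Point \<open>i\<close> of the longer row then
  carries the weight \<open>1 - (i + 1) / (w + 2)\<close> from its own average and
  \<open>i / (w + 2)\<close> from the previous one, together the ratio of the row lengths; hence the
  mean square does not grow.\<close>

lemma sum_shrink_square: "(\<Sum>i\<le>w. (shrink w v i)\<^sup>2) \<le> (real w + 1) / (real w + 2) * (\<Sum>i\<le>Suc w. (v i)\<^sup>2)"
proof -
  have weights: "1 - (real i + 1) / (real w + 2) + real i / (real w + 2) = (real w + 1) / (real w + 2)" for i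
  proof -
    define d where "d = real w + 2"
    then have "real w + 1 = d - 1" "d \<noteq> 0" by auto
    then show ?thesis unfolding d_def[symmetric] by (simp add: field_simps)
  qed
  have "(\<Sum>i\<le>w. (shrink w v i)\<^sup>2) \<le>
      (\<Sum>i\<le>w. (1 - (real i + 1) / (real w + 2)) * (v i)\<^sup>2 + (real i + 1) / (real w + 2) * (v (Suc i))\<^sup>2)"
    unfolding shrink_def by (intro sum_mono convex_square) auto
  also have "\<dots> = (\<Sum>i\<le>w. (1 - (real i + 1) / (real w + 2)) * (v i)\<^sup>2) +
      (\<Sum>i\<le>w. real (Suc i) / (real w + 2) * (v (Suc i))\<^sup>2)"
    by (simp add: sum.distrib add.commute)
  \<comment> \<open>The added term \<open>i = Suc w\<close> has coefficient 0, and so has the term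
    \<open>i = 0\<close> added by the index shift below.\<close>
  also have "(\<Sum>i\<le>w. (1 - (real i + 1) / (real w + 2)) * (v i)\<^sup>2) =
      (\<Sum>i\<le>Suc w. (1 - (real i + 1) / (real w + 2)) * (v i)\<^sup>2)"
    by (simp add: add.commute)
  also have "(\<Sum>i\<le>w. real (Suc i) / (real w + 2) * (v (Suc i))\<^sup>2) =
      (\<Sum>i\<le>Suc w. real i / (real w + 2) * (v i)\<^sup>2)"
    by (subst sum.atMost_Suc_shift) simp
  also have "(\<Sum>i\<le>Suc w. (1 - (real i + 1) / (real w + 2)) * (v i)\<^sup>2) + (\<Sum>i\<le>Suc w. real i / (real w + 2) * (v i)\<^sup>2) =
      (\<Sum>i\<le>Suc w. (real w + 1) / (real w + 2) * (v i)\<^sup>2)"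
    by (simp only: sum.distrib[symmetric] distrib_right[symmetric]) (simp only: weights)
  finally show ?thesis by (simp only: sum_distrib_left)
qed

lemma shrink_diff_square: 
  assumes "i \<le> w"
  shows "(x - shrink w v i)\<^sup>2 \<le> (x - v i)\<^sup>2 + (x - v (Suc i))\<^sup>2"
proof -
  define \<alpha> where "\<alpha> = (real i + 1) / (real w + 2)"
  have \<alpha>: "0 \<le> \<alpha>" "\<alpha> \<le> 1" using assms by (auto simp: \<alpha>_def)
  have "x - shrink w v i = (1 - \<alpha>) * (x - v i) + \<alpha> * (x - v (Suc i))"
    unfolding shrink_def \<alpha>_def[symmetric] by (simp add: algebra_simps)
  then have "(x - shrink w v i)\<^sup>2 \<le> (1 - \<alpha>) * (x - v i)\<^sup>2 + \<alpha> * (x - v (Suc i))\<^sup>2"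
    using convex_square[OF \<alpha>] by simp
  also have "\<dots> \<le> 1 * (x - v i)\<^sup>2 + 1 * (x - v (Suc i))\<^sup>2"
    using \<alpha> by (intro add_mono mult_right_mono) auto
  finally show ?thesis by simp
qed


lemma sum_rows:
  fixes h :: "nat \<Rightarrow> nat \<Rightarrow> real"
  shows "(\<Sum>(i, z)\<in>{..w} \<times> sheets. h i z) = (\<Sum>z\<in>sheets. \<Sum>i\<le>w. h i z)"
  by (subst sum.swap) (rule sum.cartesian_product[symmetric])

lemma L2_set_triangle_diff: "L2_set x A \<le> L2_set y A + L2_set (\<lambda>p. x p - y p) A"
  using L2_set_triangle_ineq[of y "\<lambda>p. x p - y p" A] by simp

section \<open>Row norms and energies\<close>

context staircase
begin

definition row_norm :: "real \<Rightarrow> (nat \<Rightarrow> real) \<Rightarrow> nat \<Rightarrow> real" where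
  "row_norm c f s = L2_set (\<lambda>(i, z). f (vtx i s z) - c) ({..\<rho> s} \<times> sheets)"

text \<open>Each sheet contributes a path, and the edge at \<open>i = 0\<close> joins the two paths;
  connecting all points of the row is enough for \<open>row_norm_ring\<close>.\<close>

definition row_energy :: "(nat \<Rightarrow> real) \<Rightarrow> nat \<Rightarrow> real" where
  "row_energy f s = (\<Sum>z\<in>sheets. \<Sum>i<\<rho> s. (f (vtx i s z) - f (vtx (Suc i) s z))\<^sup>2) +
     (f (vtx 0 s 0) - f (vtx 0 s 1))\<^sup>2"

text \<open>Diagonals enter only where the row widens, because there \<open>shrink\<close> mixes the
  points \<open>i\<close> and \<open>Suc i\<close> of the next row.\<close>

definition step_energy :: "(nat \<Rightarrow> real) \<Rightarrow> nat \<Rightarrow> real" where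
  "step_energy f s = (\<Sum>z\<in>sheets. \<Sum>i\<le>\<rho> s. (f (vtx i s z) - f (vtx i (Suc s) z))\<^sup>2 +
     (if \<rho> (Suc s) = \<rho> s then 0 else (f (vtx i s z) - f (vtx (Suc i) (Suc s) z))\<^sup>2))"

lemma row_norm_nonneg: "0 \<le> row_norm c f s"
  by (simp add: row_norm_def)

lemma row_norm_sq: "(row_norm c f s)\<^sup>2 = (\<Sum>z\<in>sheets. \<Sum>i\<le>\<rho> s. (f (vtx i s z) - c)\<^sup>2)"
  unfolding row_norm_def L2_set_def sum_rows[symmetric]
  by (subst real_sqrt_pow2) (auto intro!: sum_nonneg sum.cong)

lemma row_energy_nonneg: "0 \<le> row_energy f s"
  unfolding row_energy_def by (intro add_nonneg_nonneg sum_nonneg) auto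

lemma step_energy_nonneg: "0 \<le> step_energy f s"
  unfolding step_energy_def by (intro sum_nonneg) auto

lemma row_norm_constant_step:
  assumes "\<rho> (Suc s) = \<rho> s"
  shows "\<bar>row_norm c f s - row_norm c f (Suc s)\<bar> \<le> sqrt (step_energy f s)"
proof -
  let ?A = "{..\<rho> s} \<times> sheets"
  let ?x = "\<lambda>(i, z). f (vtx i s z) - c" and ?y = "\<lambda>(i, z). f (vtx i (Suc s) z) - c"
  have d: "L2_set (\<lambda>p. ?x p - ?y p) ?A = sqrt (step_energy f s)" 
    "L2_set (\<lambda>p. ?y p - ?x p) ?A = sqrt (step_energy f s)"
    using assms by (simp_all add: L2_set_def step_energy_def case_prod_beta power2_commute flip: sum_rows)
  have "L2_set ?x ?A \<le> L2_set ?y ?A + L2_set (\<lambda>p. ?x p - ?y p) ?A"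
    by (rule L2_set_triangle_diff)
  moreover have "L2_set ?y ?A \<le> L2_set ?x ?A + L2_set (\<lambda>p. ?y p - ?x p) ?A"
    by (rule L2_set_triangle_diff)
  ultimately show ?thesis
    unfolding d using assms by (simp add: row_norm_def)
qed

text \<open>Triangle inequality against the next row, averaged by \<open>shrink\<close> if it is
  longer. Dividing by the square root of the row length absorbs the factor of
  \<open>sum_shrink_square\<close>; a factor above 1 left on the next row would accumulate over the
  many steps.\<close>

lemma row_norm_step:
  "row_norm c f s / sqrt (real (\<rho> s) + 1) \<le>
     row_norm c f (Suc s) / sqrt (real (\<rho> (Suc s)) + 1) + sqrt (step_energy f s) / sqrt (real (\<rho> s) + 1)"
proof (cases "\<rho> (Suc s) = \<rho> s")
  case True
  then have "row_norm c f s \<le> row_norm c f (Suc s) + sqrt (step_energy f s)"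
    using row_norm_constant_step[OF True, of c f] by linarith
  then have "row_norm c f s / sqrt (real (\<rho> s) + 1) \<le>
      (row_norm c f (Suc s) + sqrt (step_energy f s)) / sqrt (real (\<rho> s) + 1)"
    by (intro divide_right_mono) auto
  then show ?thesis using True by (simp add: add_divide_distrib)
next
  case False
  define w where "w = \<rho> s"
  have w: "\<rho> (Suc s) = Suc w" using False \<rho>_mono[of s] \<rho>_step[of s] by (simp add: w_def)
  let ?A = "{..w} \<times> sheets"
  let ?x = "\<lambda>(i, z). f (vtx i s z) - c" and ?y = "\<lambda>(i, z). shrink w (\<lambda>i. f (vtx i (Suc s) z) - c) i"
  have "row_norm c f s = L2_set ?x ?A" by (simp add: row_norm_def w_def)
  also have "\<dots> \<le> L2_set ?y ?A + L2_set (\<lambda>p. ?x p - ?y p) ?A"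
    by (rule L2_set_triangle_diff)
  also have "L2_set ?y ?A \<le> sqrt ((real w + 1) / (real w + 2) * (row_norm c f (Suc s))\<^sup>2)"
  proof -
    have "(\<Sum>(i, z)\<in>?A. (shrink w (\<lambda>i. f (vtx i (Suc s) z) - c) i)\<^sup>2) \<le>
        (real w + 1) / (real w + 2) * (row_norm c f (Suc s))\<^sup>2"
      unfolding sum_rows row_norm_sq w sum_distrib_left[of _ _ "sheets"]
      by (intro sum_mono sum_shrink_square)
    then show ?thesis by (simp add: L2_set_def case_prod_beta)
  qed
  also have "L2_set (\<lambda>p. ?x p - ?y p) ?A \<le> sqrt (step_energy f s)"
  proof -
    have "(\<Sum>(i, z)\<in>?A. (f (vtx i s z) - c - shrink w (\<lambda>i. f (vtx i (Suc s) z) - c) i)\<^sup>2) \<le> step_energy f s"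
      unfolding sum_rows step_energy_def w_def[symmetric]
    proof (intro sum_mono)
      fix z i assume "i \<in> {..w}"
      then show "(f (vtx i s z) - c - shrink w (\<lambda>i. f (vtx i (Suc s) z) - c) i)\<^sup>2 \<le>
          (f (vtx i s z) - f (vtx i (Suc s) z))\<^sup>2 +
          (if \<rho> (Suc s) = w then 0 else (f (vtx i s z) - f (vtx (Suc i) (Suc s) z))\<^sup>2)"
        using shrink_diff_square[of i w "f (vtx i s z) - c" "\<lambda>i. f (vtx i (Suc s) z) - c"] w by simp
    qed
    then show ?thesis by (simp add: L2_set_def case_prod_beta)
  qed
  finally have "row_norm c f s / sqrt (real w + 1) \<le>
      (sqrt ((real w + 1) / (real w + 2) * (row_norm c f (Suc s))\<^sup>2) + sqrt (step_energy f s)) / sqrt (real w + 1)"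
    by (simp add: divide_right_mono)
  also have "\<dots> = row_norm c f (Suc s) / sqrt (real w + 2) + sqrt (step_energy f s) / sqrt (real w + 1)"
  proof -
    have "sqrt ((real w + 1) / (real w + 2) * (row_norm c f (Suc s))\<^sup>2) =
        sqrt (real w + 1) * (row_norm c f (Suc s) / sqrt (real w + 2))"
      by (simp add: real_sqrt_mult real_sqrt_divide row_norm_nonneg)
    moreover have "sqrt (real w + 1) \<noteq> 0" by simp
    ultimately show ?thesis by (simp add: add_divide_distrib)
  qed
  finally show ?thesis by (simp add: w_def[symmetric] w add.commute)
qed

lemma row_norm_constant_rows:
  assumes const: "\<And>s. T \<le> s \<Longrightarrow> \<rho> s = \<rho> T"
    and "s \<in> {T..T + m}" "s' \<in> {T..T + m}"
  shows "row_norm c f s \<le> row_norm c f s' + (\<Sum>t\<in>{T..<T + m}. sqrt (step_energy f t))"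
proof -
  have *: "\<bar>row_norm c f s - row_norm c f s'\<bar> \<le> (\<Sum>t\<in>{s..<s'}. sqrt (step_energy f t))"
    if "T \<le> s" "s \<le> s'" for s s'
    using that(2)
  proof (induction rule: dec_induct)
    case (step n)
    have "\<rho> (Suc n) = \<rho> n" using const[of n] const[of "Suc n"] that step by simp
    from row_norm_constant_step[OF this, of c f] show ?case using step by simp
  qed simp
  have mono: "(\<Sum>t\<in>{s..<s'}. sqrt (step_energy f t)) \<le> (\<Sum>t\<in>{T..<T + m}. sqrt (step_energy f t))"
    if "T \<le> s" "s' \<le> T + m" for s s'
    using that step_energy_nonneg by (intro sum_mono2) auto
  show ?thesis
    using *[of s s'] *[of s' s] mono[of s s'] mono[of s' s] assms(2,3) by (cases "s \<le> s'") auto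
qed

text \<open>Each point is reached from \<open>vtx 0 s 0\<close> by at most \<open>\<rho> s\<close>
  edges of its sheet, after the edge between the sheets if needed. Cauchy-Schwarz gives
  \<open>2 * \<rho> s\<close> times the energy for each of the \<open>2 * (\<rho> s + 1)\<close>
  points.\<close>

lemma row_norm_ring:
  "(row_norm (f (vtx 0 s 0)) f s)\<^sup>2 \<le> 4 * real (\<rho> s) * (real (\<rho> s) + 1) * row_energy f s"
proof -
  define w where "w = \<rho> s"
  define c where "c = f (vtx 0 s 0)"
  define r where "r = c - f (vtx 0 s 1)"
  define D where "D z = (\<Sum>j<w. (f (vtx j s z) - f (vtx (Suc j) s z))\<^sup>2)" for z
  have D_nn: "0 \<le> D z" for z by (simp add: D_def sum_nonneg)
  have energy: "row_energy f s = D 0 + D 1 + r\<^sup>2"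
    by (simp add: row_energy_def D_def w_def r_def c_def sheets_def)
  have path: "(f (vtx 0 s z) - f (vtx i s z))\<^sup>2 \<le> real w * D z" if "i \<le> w" for i z
  proof -
    have "f (vtx 0 s z) - f (vtx i s z) = (\<Sum>j<i. f (vtx j s z) - f (vtx (Suc j) s z))"
      using sum_lessThan_telescope'[of "\<lambda>j. f (vtx j s z)" i] by simp
    then have "(f (vtx 0 s z) - f (vtx i s z))\<^sup>2 \<le> (\<Sum>j<i. (f (vtx j s z) - f (vtx (Suc j) s z))\<^sup>2) * real (card {..<i})"
      using sum_squared_le_sum_of_squares[of "\<lambda>j. f (vtx j s z) - f (vtx (Suc j) s z)" "{..<i}"] by (simp add: mult.commute)
    also have "\<dots> \<le> D z * real w"
      unfolding D_def using that by (intro mult_mono sum_mono2) (auto intro: sum_nonneg)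
    finally show ?thesis by (simp add: mult.commute)
  qed
  have w1: "1 \<le> real w" using \<rho>_pos[of s] by (simp add: w_def)
  have bound: "(f (vtx i s z) - c)\<^sup>2 \<le> 2 * real w * row_energy f s" if "i \<le> w" "z \<le> 1" for i z
  proof (cases "z = 0")
    case True
    then have "(f (vtx i s z) - c)\<^sup>2 \<le> real w * D 0"
      using path[OF that(1), of 0] by (simp add: c_def power2_commute)
    also have "\<dots> \<le> real w * (2 * row_energy f s)"
      unfolding energy using D_nn[of 0] D_nn[of 1] w1 by (intro mult_left_mono) auto
    finally show ?thesis by simp
  next
    case False
    then have z: "z = 1" using that by simp
    define x where "x = f (vtx 0 s 1) - f (vtx i s 1)"
    have "(f (vtx i s z) - c)\<^sup>2 = (x + r)\<^sup>2" by (simp add: z x_def r_def power2_commute)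
    also have "\<dots> \<le> 2 * x\<^sup>2 + 2 * r\<^sup>2"
      using sum_squares_bound[of x r] by (simp add: power2_sum)
    also have "\<dots> \<le> 2 * (real w * D 1) + 2 * (real w * r\<^sup>2)"
      using path[OF that(1), of 1] w1 by (intro add_mono mult_left_mono) (auto simp: x_def mult_le_cancel_right1)
    also have "\<dots> \<le> 2 * real w * row_energy f s"
      unfolding energy using D_nn[of 0] by (simp add: algebra_simps)
    finally show ?thesis .
  qed
  have "(row_norm c f s)\<^sup>2 \<le> (\<Sum>z\<in>sheets. \<Sum>i\<le>w. 2 * real w * row_energy f s)"
    unfolding row_norm_sq w_def[symmetric] using bound by (intro sum_mono) auto
  also have "\<dots> = 4 * real w * (real w + 1) * row_energy f s" by (simp add: algebra_simps)
  finally show ?thesis by (simp add: c_def w_def)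
qed

text \<open>The horizontal edges and the edges between the sheets are each bounded by the whole
  energy, hence the factor 2.\<close>

lemma sum_row_energy: "(\<Sum>s\<le>S. row_energy f s) \<le> 2 * dirichlet skel f"
proof -
  let ?J = "SIGMA s:{..S}. SIGMA z:sheets. {..<\<rho> s}"
  have "(\<Sum>(s, z, i)\<in>?J. (f (vtx i s z) - f (vtx (Suc i) s z))\<^sup>2) \<le> dirichlet skel f"
    using skel.dirichlet_ge_sum[of ?J "\<lambda>(s, z, i). vtx i s z" "\<lambda>(s, z, i). vtx (Suc i) s z" f] edge_horizontal
    by (auto simp: inj_on_def case_prod_beta)
  moreover have "(\<Sum>(s, z, i)\<in>?J. (f (vtx i s z) - f (vtx (Suc i) s z))\<^sup>2) =
      (\<Sum>s\<le>S. \<Sum>z\<in>sheets. \<Sum>i<\<rho> s. (f (vtx i s z) - f (vtx (Suc i) s z))\<^sup>2)"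
    by (simp add: sum.Sigma case_prod_beta)
  moreover have "(\<Sum>s\<le>S. (f (vtx 0 s 0) - f (vtx 0 s 1))\<^sup>2) \<le> dirichlet skel f"
    using skel.dirichlet_ge_sum[of "{..S}" "\<lambda>s. vtx 0 s 0" "\<lambda>s. vtx 0 s 1" f] edge_rim
    by (auto simp: inj_on_def)
  ultimately show ?thesis by (simp only: row_energy_def sum.distrib)
qed

lemma sum_step_energy: "(\<Sum>s<S. step_energy f s) \<le> 2 * dirichlet skel f"
proof -
  let ?J = "SIGMA s:{..<S}. SIGMA z:sheets. {..\<rho> s}"
  let ?J' = "SIGMA s:{s. s < S \<and> \<rho> (Suc s) \<noteq> \<rho> s}. SIGMA z:sheets. {..\<rho> s}"
  have fin: "finite {s. s < S \<and> \<rho> (Suc s) \<noteq> \<rho> s}" by simp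
  have "(\<Sum>(s, z, i)\<in>?J. (f (vtx i s z) - f (vtx i (Suc s) z))\<^sup>2) \<le> dirichlet skel f"
    using skel.dirichlet_ge_sum[of ?J "\<lambda>(s, z, i). vtx i s z" "\<lambda>(s, z, i). vtx i (Suc s) z" f] edge_vertical
    by (auto simp: inj_on_def case_prod_beta)
  moreover have "(\<Sum>(s, z, i)\<in>?J. (f (vtx i s z) - f (vtx i (Suc s) z))\<^sup>2) =
      (\<Sum>s<S. \<Sum>z\<in>sheets. \<Sum>i\<le>\<rho> s. (f (vtx i s z) - f (vtx i (Suc s) z))\<^sup>2)"
    by (simp add: sum.Sigma case_prod_beta)
  moreover have "(\<Sum>(s, z, i)\<in>?J'. (f (vtx i s z) - f (vtx (Suc i) (Suc s) z))\<^sup>2) \<le> dirichlet skel f"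
  proof -
    have "Suc i \<le> \<rho> (Suc s)" if "i \<le> \<rho> s" "\<rho> (Suc s) \<noteq> \<rho> s" for i s
      using that \<rho>_mono[of s] by simp
    then show ?thesis
      using skel.dirichlet_ge_sum[of ?J' "\<lambda>(s, z, i). vtx i s z" "\<lambda>(s, z, i). vtx (Suc i) (Suc s) z" f] edge_diagonal fin
      by (auto simp: inj_on_def case_prod_beta)
  qed
  moreover have "(\<Sum>(s, z, i)\<in>?J'. (f (vtx i s z) - f (vtx (Suc i) (Suc s) z))\<^sup>2) =
      (\<Sum>s<S. \<Sum>z\<in>sheets. \<Sum>i\<le>\<rho> s. if \<rho> (Suc s) = \<rho> s then 0 else (f (vtx i s z) - f (vtx (Suc i) (Suc s) z))\<^sup>2)"
  proof -
    have "(\<Sum>(s, z, i)\<in>?J'. (f (vtx i s z) - f (vtx (Suc i) (Suc s) z))\<^sup>2) =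
      (\<Sum>s\<in>{s. s < S \<and> \<rho> (Suc s) \<noteq> \<rho> s}. \<Sum>z\<in>sheets. \<Sum>i\<le>\<rho> s. (f (vtx i s z) - f (vtx (Suc i) (Suc s) z))\<^sup>2)"
      using fin by (simp add: sum.Sigma case_prod_beta)
    also have "\<dots> = (\<Sum>s<S. \<Sum>z\<in>sheets. \<Sum>i\<le>\<rho> s. if \<rho> (Suc s) = \<rho> s then 0 else (f (vtx i s z) - f (vtx (Suc i) (Suc s) z))\<^sup>2)"
      by (rule sum.mono_neutral_cong_left) auto
    finally show ?thesis .
  qed
  ultimately show ?thesis by (simp only: step_energy_def sum.distrib)
qed

text \<open>The constant is the value of \<open>f\<close> at a point of the cylinder row of least
  energy. \<open>row_norm_ring\<close> controls \<open>f - c\<close> in that row, step energies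
  carry the bound through the cylinder, and \<open>hardy\<close> carries it down the cusp from row
  \<open>T\<close>.\<close>

lemma poincare:
  assumes m: "m = 4 ^ K" and S: "S = K * m + m"
    and low: "\<And>s. s < K * m \<Longrightarrow> 4 ^ (s div m) \<le> \<rho> s \<and> \<rho> s \<le> 4 * 4 ^ (s div m)"
    and top: "\<And>s. K * m \<le> s \<Longrightarrow> \<rho> s = m"
  shows "\<exists>c. (\<Sum>x\<in>verts skel. (f x - c)\<^sup>2) \<le> 200 * (real m)\<^sup>2 * dirichlet skel f"
proof -
  define T where "T = K * m"
  define E where "E = dirichlet skel f"
  have E: "0 \<le> E" by (simp add: E_def skel.dirichlet_nonneg)
  have m1: "1 \<le> real m" by (simp add: m)
  obtain s0 where s0: "s0 \<in> {T..S}" "\<And>s. s \<in> {T..S} \<Longrightarrow> row_energy f s0 \<le> row_energy f s"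
    using ex_is_arg_min_if_finite[of "{T..S}" "row_energy f"] S unfolding is_arg_min_linorder T_def by auto
  define c where "c = f (vtx 0 s0 0)"
  define a where "a = row_norm c f"
  define e where "e s = sqrt (step_energy f s)" for s
  have a_nn: "0 \<le> a s" and e_nn: "0 \<le> e s" for s
    by (simp_all add: a_def e_def row_norm_nonneg step_energy_nonneg)
  have e_sq: "(e s)\<^sup>2 = step_energy f s" for s by (simp add: e_def step_energy_nonneg)
  \<comment> \<open>The least of \<open>m + 1\<close> row energies is at most their average; this
    gain of order \<open>m\<close> pays for one of the two factors \<open>m\<close> lost in
    \<open>row_norm_ring\<close>.\<close>
  have "(real m + 1) * row_energy f s0 = (\<Sum>s\<in>{T..S}. row_energy f s0)"
    by (simp add: S T_def)
  also have "\<dots> \<le> (\<Sum>s\<in>{T..S}. row_energy f s)" using s0 by (intro sum_mono) auto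
  also have "\<dots> \<le> (\<Sum>s\<le>S. row_energy f s)" using row_energy_nonneg by (intro sum_mono2) auto
  also have "\<dots> \<le> 2 * E" unfolding E_def by (rule sum_row_energy)
  finally have ring: "(real m + 1) * row_energy f s0 \<le> 2 * E" .
  have "(a s0)\<^sup>2 \<le> 4 * real (\<rho> s0) * (real (\<rho> s0) + 1) * row_energy f s0"
    unfolding a_def c_def by (rule row_norm_ring)
  also have "\<dots> = 4 * real m * ((real m + 1) * row_energy f s0)"
    using top[of s0] s0(1) by (simp add: T_def)
  also have "\<dots> \<le> 4 * real m * (2 * E)" using ring by (intro mult_left_mono) auto
  finally have a0: "(a s0)\<^sup>2 \<le> 8 * real m * E" by simp
  have sum_e: "(\<Sum>s\<in>A. (e s)\<^sup>2) \<le> 2 * E" if "A \<subseteq> {..<S}" for A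
  proof -
    have "(\<Sum>s\<in>A. (e s)\<^sup>2) \<le> (\<Sum>s<S. step_energy f s)"
      unfolding e_sq using that step_energy_nonneg by (intro sum_mono2) auto
    also have "\<dots> \<le> 2 * E" unfolding E_def by (rule sum_step_energy)
    finally show ?thesis .
  qed
  have a_top: "(a s)\<^sup>2 \<le> 20 * real m * E" if "s \<in> {T..S}" for s
  proof -
    define \<Sigma> where "\<Sigma> = (\<Sum>t\<in>{T..<S}. e t)"
    have "a s \<le> a s0 + \<Sigma>"
      using row_norm_constant_rows[of T s m s0 c f] top that s0(1) S by (simp add: a_def \<Sigma>_def e_def T_def)
    then have "(a s)\<^sup>2 \<le> (a s0 + \<Sigma>)\<^sup>2" using a_nn by (intro power_mono) auto
    also have "\<dots> \<le> 2 * (a s0)\<^sup>2 + 2 * \<Sigma>\<^sup>2"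
      using sum_squares_bound[of "a s0" \<Sigma>] by (simp add: power2_sum)
    \<comment> \<open>At most \<open>m\<close> steps are crossed; with \<open>a0\<close> the
      constant becomes 2 * 8 + 2 * 2 = 20.\<close>
    also have "\<Sigma>\<^sup>2 \<le> (\<Sum>t\<in>{T..<S}. (e t)\<^sup>2) * real m"
      using sum_squared_le_sum_of_squares[of e "{T..<S}"] S by (simp add: \<Sigma>_def T_def mult.commute)
    also have "\<dots> \<le> 2 * E * real m" by (intro mult_right_mono sum_e) auto
    finally show ?thesis using a0 by (simp add: algebra_simps)
  qed
  have "(\<Sum>s<T. (a s)\<^sup>2) \<le> 4 * real m * (a T)\<^sup>2 + 40 * (real m)\<^sup>2 * (\<Sum>s<T. (e s)\<^sup>2)"
    unfolding T_def
  proof (rule hardy[where N = "\<lambda>s. real (\<rho> s) + 1"])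
    show "4 ^ (s div m) \<le> real (\<rho> s) + 1" "real (\<rho> s) + 1 \<le> 5 * 4 ^ (s div m)" if "s < K * m" for s
    proof -
      have "4 ^ (s div m) \<le> real (\<rho> s)" "real (\<rho> s) \<le> 4 * 4 ^ (s div m)"
        using low[OF that] of_nat_mono[of "4 ^ (s div m)" "\<rho> s", where 'a = real]
          of_nat_mono[of "\<rho> s" "4 * 4 ^ (s div m)", where 'a = real] by simp_all
      moreover have "(1 :: real) \<le> 4 ^ (s div m)" by simp
      ultimately show "4 ^ (s div m) \<le> real (\<rho> s) + 1" "real (\<rho> s) + 1 \<le> 5 * 4 ^ (s div m)" by linarith+
    qed
    show "4 ^ K \<le> real (\<rho> (K * m)) + 1" using top[of "K * m"] by (simp add: m)
    show "a s / sqrt (real (\<rho> s) + 1) \<le> a (Suc s) / sqrt (real (\<rho> (Suc s)) + 1) + e s / sqrt (real (\<rho> s) + 1)" for s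
      unfolding a_def e_def by (rule row_norm_step)
  qed (use m a_nn e_nn in auto)
  \<comment> \<open>4 * 20 + 40 * 2 = 160, to which the cylinder adds 40.\<close>
  also have "\<dots> \<le> 4 * real m * (20 * real m * E) + 40 * (real m)\<^sup>2 * (2 * E)"
    using S by (intro add_mono mult_left_mono a_top sum_e) (auto simp: T_def)
  also have "\<dots> = 160 * (real m)\<^sup>2 * E" by (simp add: power2_eq_square)
  finally have lower: "(\<Sum>s<T. (a s)\<^sup>2) \<le> 160 * (real m)\<^sup>2 * E" .
  have "(\<Sum>s\<in>{T..S}. (a s)\<^sup>2) \<le> (\<Sum>s\<in>{T..S}. 20 * real m * E)" by (intro sum_mono a_top)
  also have "\<dots> = 20 * real m * E * (real m + 1)" by (simp add: S T_def)
  also have "\<dots> \<le> 20 * real m * E * (2 * real m)" using m1 E by (intro mult_left_mono) auto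
  also have "\<dots> = 40 * (real m)\<^sup>2 * E" by (simp add: power2_eq_square)
  finally have upper: "(\<Sum>s\<in>{T..S}. (a s)\<^sup>2) \<le> 40 * (real m)\<^sup>2 * E" .
  have "(\<Sum>x\<in>verts skel. (f x - c)\<^sup>2) = (\<Sum>s\<le>S. (a s)\<^sup>2)"
    by (simp add: verts_skel sum_vset a_def row_norm_sq sum_rows)
  also have "{..S} = {..<T} \<union> {T..S}" using S by (auto simp: T_def)
  also have "(\<Sum>s\<in>{..<T} \<union> {T..S}. (a s)\<^sup>2) = (\<Sum>s<T. (a s)\<^sup>2) + (\<Sum>s\<in>{T..S}. (a s)\<^sup>2)"
    by (intro sum.union_disjoint) auto
  also have "\<dots> \<le> 200 * (real m)\<^sup>2 * E" using lower upper by simp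
  finally show ?thesis unfolding E_def by blast
qed

end


section \<open>The cusps\<close>

text \<open>Block \<open>k < K\<close> of \<open>4 ^ K\<close> rows widens from \<open>4 ^ k\<close> to \<open>4 ^ Suc k\<close>; the last block is a
  cylinder of length and width \<open>4 ^ K\<close>.\<close>

definition profile :: "nat \<Rightarrow> nat \<Rightarrow> nat" where
  "profile K s = (if K * 4 ^ K \<le> s then 4 ^ K
     else 4 ^ (s div 4 ^ K) + min (s mod 4 ^ K) (3 * 4 ^ (s div 4 ^ K)))"

lemma profile_block:
  assumes "k < K" "r < 4 ^ K"
  shows "profile K (k * 4 ^ K + r) = 4 ^ k + min r (3 * 4 ^ k)"
proof -
  have "k * 4 ^ K + r < Suc k * 4 ^ K" using assms by simp
  also have "\<dots> \<le> K * 4 ^ K" using assms by (intro mult_le_mono1) simp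
  finally show ?thesis using assms by (simp add: profile_def)
qed

lemma profile_step: "profile K s \<le> profile K (Suc s) \<and> profile K (Suc s) \<le> Suc (profile K s)"
proof (cases "K * 4 ^ K \<le> s")
  case True
  then show ?thesis by (simp add: profile_def)
next
  case False
  define m :: nat where "m = 4 ^ K"
  define k where "k = s div m"
  define r where "r = s mod m"
  have m: "0 < m" by (simp add: m_def)
  have s: "s = k * m + r" "r < m" using m by (simp_all add: k_def r_def)
  have k: "k < K" using False m by (simp add: k_def m_def[symmetric] div_less_iff_less_mult not_le)
  have ps: "profile K s = 4 ^ k + min r (3 * 4 ^ k)"
    using profile_block[OF k, of r] s by (simp add: m_def)
  \<comment> \<open>The widening of block \<open>k\<close> takes \<open>3 * 4 ^ k\<close> rows and
    is complete by the last row of the block, so the next block starts at the width already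
    reached.\<close>
  have mk: "4 * 4 ^ k \<le> m"
    using k power_increasing[of "Suc k" K "4::nat"] by (simp add: m_def)
  show ?thesis
  proof (cases "Suc r < m")
    case True
    then have "profile K (Suc s) = 4 ^ k + min (Suc r) (3 * 4 ^ k)"
      using profile_block[OF k, of "Suc r"] s by (simp add: m_def)
    then show ?thesis unfolding ps by (simp add: min_def)
  next
    case False
    then have r: "Suc r = m" using s by simp
    then have Suc_s: "Suc s = Suc k * m + 0" using s by simp
    have "profile K (Suc s) = 4 ^ Suc k"
    proof (cases "Suc k < K")
      case True
      then show ?thesis using profile_block[OF True, of 0] Suc_s by (simp add: m_def)
    next
      case False
      then have "Suc k = K" using k by simp
      then show ?thesis using Suc_s by (simp add: profile_def m_def)
    qed
    moreover have "(1::nat) \<le> 4 ^ k" by simp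
    ultimately show ?thesis
      unfolding ps using r mk by (simp add: min_def)
  qed
qed

abbreviation height :: "nat \<Rightarrow> nat" where
  "height K \<equiv> K * 4 ^ K + 4 ^ K"

interpretation stairs: staircase "height K" "profile K" for K
  by unfold_locales (use profile_step in \<open>auto simp: profile_def\<close>)

lemma poincare_profile:
  "\<exists>c. (\<Sum>x\<in>verts (stairs.skel K). (f x - c)\<^sup>2) \<le> 200 * (4 ^ K)\<^sup>2 * dirichlet (stairs.skel K) f"
proof -
  have "\<exists>c. (\<Sum>x\<in>verts (stairs.skel K). (f x - c)\<^sup>2) \<le> 200 * (real (4 ^ K))\<^sup>2 * dirichlet (stairs.skel K) f"
    by (rule stairs.poincare[where K = K]) (auto simp: profile_def)
  then show ?thesis by simp
qed

lemma lambda1_profile: "lambda1 (stairs.skel K) \<ge> 1 / (400 * (4 ^ K)\<^sup>2)"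
proof -
  have "lambda1 (stairs.skel K) \<ge> 1 / (2 * (200 * (4 ^ K)\<^sup>2))"
    by (rule stairs.skel.lambda1_ge[where a = "vtx 0 0 0" and b = "vtx 0 0 1"])
      (use poincare_profile in \<open>auto simp: stairs.verts_skel stairs.vtx_in_vset\<close>)
  then show ?thesis by simp
qed

lemma diam_profile: "graph_diam (stairs.skel K) \<ge> height K"
proof -
  have v: "vtx 0 0 0 \<in> verts (stairs.skel K)" "vtx 0 (height K) 0 \<in> verts (stairs.skel K)"
    by (simp_all add: stairs.verts_skel stairs.vtx_in_vset)
  have "crd (vtx 0 (height K) 0) 1 - crd (vtx 0 0 0) 1 \<le> graph_diam (stairs.skel K)"
    using stairs.edge_height stairs.skel.connected_of_poincare[OF poincare_profile v] v
    by (intro stairs.skel.graph_diam_ge) auto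
  then show ?thesis by simp
qed

section \<open>Comparison with the diameter and choice of the sequence\<close>

lemma ln_div_antimono:
  fixes x y :: real
  assumes "3 \<le> x" "x \<le> y"
  shows "ln y / y \<le> ln x / x"
proof -
  have "exp 1 \<le> (3::real)" by (rule exp_le)
  then have "exp 1 \<le> x" using assms by linarith
  then show ?thesis
    using assms ln_x_over_x_mono by blast
qed

text \<open>\<open>ln x / x\<close> decreases from 3 on, so \<open>D\<close> may be replaced by its
  lower bound \<open>height K\<close>, which \<open>1 \<le> K\<close> brings above 3. The logarithm
  of \<open>height K\<close> is at most \<open>3 * K\<close>, which gives the bound 3 / 4 ^ K; and 9
  * 400 = 3600.\<close>

lemma log_bound_profile:
  assumes "1 \<le> K" "height K \<le> D"
  shows "1 / 3600 * (ln (real D) / real D)\<^sup>2 \<le> 1 / (400 * (4 ^ K)\<^sup>2)"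
proof -
  let ?L = "real (height K)"
  have L: "?L = (real K + 1) * 4 ^ K" by (simp add: algebra_simps)
  have "4 ^ 1 \<le> (4::real) ^ K" using assms by (intro power_increasing) auto
  then have "3 \<le> ?L" unfolding L using mult_mono[of 1 "real K + 1" 4 "4 ^ K"] by simp
  moreover have D: "?L \<le> real D" using assms by (simp only: of_nat_le_iff)
  ultimately have "ln (real D) / real D \<le> ln ?L / ?L" by (intro ln_div_antimono)
  also have "ln ?L = ln (real K + 1) + real K * ln 4"
    unfolding L by (simp add: ln_mult ln_realpow)
  also have "ln (real K + 1) \<le> real K" using ln_add_one_self_le_self[of "real K"] by (simp add: add.commute)
  also have "ln (4::real) \<le> 2"
  proof -
    have "ln (4::real) = 2 * ln 2" using ln_realpow[of "2::real" 2] by simp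
    then show ?thesis using ln_2_less_1 by simp
  qed
  finally have "ln (real D) / real D \<le> (real K + real K * 2) / ?L"
    by (simp add: divide_right_mono mult_left_mono)
  also have "\<dots> \<le> 3 / 4 ^ K" unfolding L by (simp add: divide_simps)
  finally have le: "ln (real D) / real D \<le> 3 / 4 ^ K" .
  have "0 \<le> ln (real D) / real D" using \<open>3 \<le> ?L\<close> D by simp
  then have "(ln (real D) / real D)\<^sup>2 \<le> (3 / 4 ^ K)\<^sup>2" using le by (rule power_mono[rotated])
  then show ?thesis by (simp add: power_divide)
qed

text \<open>Non-isomorphism is read off from vertex counts. Their unboundedness yields a subsequence
  with distinct counts, without comparing them for different \<open>K\<close>. The index 0 is left
  out for the sake of \<open>log_bound_profile\<close>.\<close>

lemma unbounded_inj_on_infinite: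
  fixes c :: "nat \<Rightarrow> nat"
  assumes "\<And>K. K < c K"
  obtains B where "infinite B" "0 \<notin> B" "inj_on c B"
proof -
  have "infinite (c ` {1..})"
  proof
    assume "finite (c ` {1..})"
    then obtain M where M: "\<And>K. 1 \<le> K \<Longrightarrow> c K \<le> M"
      unfolding finite_nat_set_iff_bounded_le by auto
    have "c (Suc M) \<le> M" by (rule M) simp
    with assms[of "Suc M"] show False by linarith
  qed
  moreover obtain B where B: "B \<subseteq> {1..}" "inj_on c B" "c ` {1..} = c ` B"
    by (metis order_refl subset_image_inj)
  ultimately have "infinite B" by (metis finite_imageI)
  moreover have "0 \<notin> B" using B(1) by auto
  ultimately show ?thesis using that B(2) by blast
qed

lemma card_vset_profile: "K < card (stairs.vset K)"
proof -
  have "K = K * 1" by simp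
  also have "\<dots> \<le> K * 4 ^ K" by (intro mult_le_mono2) simp
  also have "\<dots> \<le> height K" by (rule le_add1)
  also have "\<dots> < card (stairs.vset K)" by (rule stairs.card_vset_ge)
  finally show ?thesis .
qed

theorem theorem1p2:
  shows "\<exists>(d::real) (C::real) (X :: nat \<Rightarrow> nat set set).
    d > 0 \<and> C > 0 \<and>
    (\<forall>n. sphere_triangulation (X n)) \<and>
    (\<forall>m n. m \<noteq> n \<longrightarrow> \<not> graph_iso (one_skeleton (X m)) (one_skeleton (X n))) \<and>
    (\<forall>n. real (graph_degree (one_skeleton (X n))) \<le> d) \<and>
    (\<forall>n. graph_diam (one_skeleton (X n)) \<ge> 2) \<and>
    (\<forall>n. lambda1 (one_skeleton (X n)) \<ge>
           C * (ln (real (graph_diam (one_skeleton (X n)))) /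
                real (graph_diam (one_skeleton (X n))))\<^sup>2)"
proof -
  obtain B where B: "infinite B" "0 \<notin> B" "inj_on (\<lambda>K. card (stairs.vset K)) B"
    by (rule unbounded_inj_on_infinite[OF card_vset_profile])
  define k where "k = enumerate B"
  have k: "k n \<in> B" "1 \<le> k n" for n
    using enumerate_in_set[OF B(1), of n] B(2) by (auto simp: k_def Suc_le_eq intro: Nat.gr0I)
  have k_inj: "k m \<noteq> k n" if "m \<noteq> n" for m n
    using that strict_mono_enumerate[OF B(1)] by (simp add: k_def strict_mono_eq)
  have sphere: "\<forall>n. sphere_triangulation (stairs.cpx (k n))"
    using stairs.sphere_triangulation_cpx by blast
  have degree: "\<forall>n. real (graph_degree (stairs.skel (k n))) \<le> 27"
    using stairs.degree_skel by (metis of_nat_le_iff of_nat_numeral)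
  have diam: "\<forall>n. 2 \<le> graph_diam (stairs.skel (k n))"
  proof
    fix n
    have "4 ^ 1 \<le> (4::nat) ^ k n" using k(2)[of n] by (intro power_increasing) auto
    then show "2 \<le> graph_diam (stairs.skel (k n))" using diam_profile[of "k n"] by simp
  qed
  have gap: "\<forall>n. 1 / 3600 * (ln (real (graph_diam (stairs.skel (k n)))) / real (graph_diam (stairs.skel (k n))))\<^sup>2
      \<le> lambda1 (stairs.skel (k n))"
    using order_trans[OF log_bound_profile[OF k(2) diam_profile] lambda1_profile] by blast
  have distinct: "\<forall>m n. m \<noteq> n \<longrightarrow> \<not> graph_iso (stairs.skel (k m)) (stairs.skel (k n))"
  proof (intro allI impI notI)
    fix m n :: nat
    assume "m \<noteq> n" and "graph_iso (stairs.skel (k m)) (stairs.skel (k n))"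
    then have "card (stairs.vset (k m)) = card (stairs.vset (k n))"
      by (auto simp: graph_iso_def stairs.verts_skel dest: bij_betw_same_card)
    then show False using inj_onD[OF B(3)] k(1) k_inj[OF \<open>m \<noteq> n\<close>] by blast
  qed
  show ?thesis
    by (rule exI[of _ 27], rule exI[of _ "1 / 3600"], rule exI[of _ "\<lambda>n. stairs.cpx (k n)"])
      (use sphere distinct degree diam gap in simp)
qed

end
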